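(* Let $X$ be a smooth complete toric variety of Picard rank $2$, given by data $\ell_1,\ell_2\ge2$ and integers $0=c^1\ge\dots\ge c^{\ell_2}$, and put $\overline{c}=\sum_{\nu=1}^{\ell_2}c^\nu$. Then $\operatorname{Imm}_{\mathbb{Z}}(X)=\operatorname{Imm}_{\mathbb{R}}(X)$. Moreover, the line bundle represented by $(x,y)\in\mathbb{Z}^2=\operatorname{Cl}(X)$ is immaculate if and only if one of the following holds: • $-\ell_2<y<0$, or • $y\ge0$ and $-\ell_1<x<c^{\ell_2}y$, or • $y\le-\ell_2$ and $0>x+\overline{c}>c^{\ell_2}(y+\ell_2)-\ell_1$.
   Context: Base field $\Bbbk$ algebraically closed. Every smooth complete $d$-dimensional toric variety of Picard rank $2$ is obtained as follows (Kleinschmidt): choose $\ell_1,\ell_2\ge2$ with $\ell_1+\ell_2=d+2$ and integers $0=c^1\ge\dots\ge c^{\ell_2}$. Let $e_1,\dots,e_{\ell_1},f_1,\dots,f_{\ell_2}$ be the standard basis of $\mathbb{Z}^{d+2}$ and let $N=\mathbb{Z}^{d+2}/(\mathbb{Z}(\underline{1},c)+\mathbb{Z}(\underline{0},\underline{1}))$, where $c=(c^1,\dots,c^{\ell_2})$ and $\underline{1},\underline{0}$ are the vectors of ones/zeros of appropriate length. The rays are the images $u_i$ of $e_i$ and $v_j$ of $f_j$; the maximal cones are generated by all rays except one $u_i$ and one $v_j$. The class map $\pi\colon\mathbb{Z}^{\Sigma(1)}\to\operatorname{Cl}(X)=\mathbb{Z}^2$ sends each $D_{u_i}$ to $(1,0)$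 and $D_{v_j}$ to $(c^j,1)$. A line bundle is immaculate if all its cohomology groups $H^i$, $i\ge0$, vanish. A space is $\Bbbk$-acyclic if it is non-empty, arcwise connected, with vanishing positive-degree singular cohomology over $\Bbbk$. A subset $\mathcal{R}\subseteq\Sigma(1)$ is tempting if $V^{>}(\mathcal{R})=\mathbb{R}_{>0}\cdot\bigcup_{\sigma\in\Sigma}\operatorname{conv}(\mathcal{R}\cap\sigma(1))\subseteq N_{\mathbb{R}}$ is not $\Bbbk$-acyclic. Put $\mathcal{M}_{\mathbb{Z}}(\mathcal{R})=\pi(\mathbb{Z}_{\ge0}^{\Sigma(1)\setminus\mathcal{R}}\times\mathbb{Z}_{\le-1}^{\mathcal{R}})$ and $\mathcal{M}_{\mathbb{R}}(\mathcal{R})=\pi(\mathbb{R}_{\ge0}^{\Sigma(1)\setminus\mathcal{R}}\times\mathbb{R}_{\le-1}^{\mathcal{R}})\subseteq\operatorname{Cl}(X)\otimes\mathbb{R}$. Then $\operatorname{Imm}_{\mathbb{Z}}(X)=\operatorname{Cl}(X)\setminus\bigcup_{\mathcal{R}\text{ tempting}}\mathcal{M}_{\mathbb{Z}}(\mathcal{R})$ (this is the set of immaculate classes) and $\operatorname{Imm}_{\mathbb{R}}(X)$ is the set of classes in $\operatorname{Cl}(X)$ whose image in $\operatorname{Cl}(X)\otimes\mathbb{R}$ lies outside $\bigcup_{\mathcal{R}\text{ tempting}}\mathcal{M}_{\mathbb{R}}(\mathcal{R})$. *)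

theory Defs
  imports "HOL-Homology.Homology" "HOL-Computational_Algebra.Polynomial"
begin

section \<open>Acyclic topological spaces\<close>

text \<open>Singular cochains with coefficients in \<open>'k\<close> are \<open>'k\<close>-valued functions on singular simplices; the
  values of \<open>f\<close> outside the singular \<open>p\<close>-simplices of the space are irrelevant.\<close>

definition singular_coboundary ::
    "nat \<Rightarrow> (((nat \<Rightarrow> real) \<Rightarrow> 'a) \<Rightarrow> 'k::field) \<Rightarrow> ((nat \<Rightarrow> real) \<Rightarrow> 'a) \<Rightarrow> 'k" where
  "singular_coboundary p f s = (\<Sum>i\<le>Suc p. (- 1) ^ i * f (singular_face (Suc p) i s))"

definition singular_cohomology_vanishes :: "'k::field itself \<Rightarrow> nat \<Rightarrow> 'a topology \<Rightarrow> bool" where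
  "singular_cohomology_vanishes _ p X \<longleftrightarrow>
     (\<forall>f :: ((nat \<Rightarrow> real) \<Rightarrow> 'a) \<Rightarrow> 'k.
        (\<forall>s. singular_simplex (Suc p) X s \<longrightarrow> singular_coboundary p f s = 0) \<longrightarrow>
        (case p of
           0 \<Rightarrow> \<forall>s. singular_simplex 0 X s \<longrightarrow> f s = 0
         | Suc q \<Rightarrow> \<exists>g :: ((nat \<Rightarrow> real) \<Rightarrow> 'a) \<Rightarrow> 'k.
                     \<forall>s. singular_simplex p X s \<longrightarrow> f s = singular_coboundary q g s))"

definition acyclic_space :: "'k::field itself \<Rightarrow> 'a topology \<Rightarrow> bool" where
  "acyclic_space k X \<longleftrightarrow>
     topspace X \<noteq> {} \<and> path_connected_space X \<and> (\<forall>p\<ge>1. singular_cohomology_vanishes k p X)"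


section \<open>Kleinschmidt's fans\<close>

text \<open>\<open>URay i\<close> and \<open>VRay j\<close> stand for the ray generators \<open>u\<^sub>i\<close> and \<open>v\<^sub>j\<close> (indices start at 1), and also
  for the basis vectors \<open>e\<^sub>i\<close> and \<open>f\<^sub>j\<close>. A vector indexed by the rays is a function
  on \<open>ray\<close> vanishing outside \<open>rays l1 l2\<close>. A cone is represented by its set of rays, which is legitimate
  as all cones of the fan are simplicial; intersection of cones is intersection of
  ray sets.\<close>

datatype ray = URay nat | VRay nat

definition rays :: "nat \<Rightarrow> nat \<Rightarrow> ray set" where
  "rays l1 l2 = URay ` {1..l1} \<union> VRay ` {1..l2}"

definition max_cones :: "nat \<Rightarrow> nat \<Rightarrow> ray set set" where
  "max_cones l1 l2 = {rays l1 l2 - {URay i, VRay j} | i j. i \<in> {1..l1} \<and> j \<in> {1..l2}}"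

definition fan :: "nat \<Rightarrow> nat \<Rightarrow> ray set set" where
  "fan l1 l2 = {S. \<exists>T\<in>max_cones l1 l2. S \<subseteq> T}"

definition class_map :: "nat \<Rightarrow> nat \<Rightarrow> (nat \<Rightarrow> int) \<Rightarrow> (ray \<Rightarrow> 'a::comm_ring_1) \<Rightarrow> 'a \<times> 'a" where
  "class_map l1 l2 c a =
     ((\<Sum>i=1..l1. a (URay i)) + (\<Sum>j=1..l2. of_int (c j) * a (VRay j)), \<Sum>j=1..l2. a (VRay j))"

text \<open>The two vectors \<open>(1,c)\<close> and \<open>(0,1)\<close> that are divided out in the definition of \<open>N\<close>.\<close>

definition relation1 :: "nat \<Rightarrow> nat \<Rightarrow> (nat \<Rightarrow> int) \<Rightarrow> ray \<Rightarrow> int" where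
  "relation1 l1 l2 c r =
     (if r \<in> rays l1 l2 then (case r of URay i \<Rightarrow> 1 | VRay j \<Rightarrow> c j) else 0)"

definition relation2 :: "nat \<Rightarrow> nat \<Rightarrow> ray \<Rightarrow> int" where
  "relation2 l1 l2 r =
     (if r \<in> rays l1 l2 then (case r of URay i \<Rightarrow> 0 | VRay j \<Rightarrow> 1) else 0)"

text \<open>The character lattice \<open>M\<close> dual to \<open>N\<close>: integral linear forms on the free module on the rays that
  vanish on both relations. The pairing of \<open>m\<close> with the generator of the ray \<open>r\<close> is \<open>m r\<close>.\<close>

definition char_lattice :: "nat \<Rightarrow> nat \<Rightarrow> (nat \<Rightarrow> int) \<Rightarrow> (ray \<Rightarrow> int) set" where
  "char_lattice l1 l2 c =
     {m. (\<forall>r. r \<notin> rays l1 l2 \<longrightarrow> m r = 0) \<and>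
         (\<Sum>r\<in>rays l1 l2. m r * relation1 l1 l2 c r) = 0 \<and>
         (\<Sum>r\<in>rays l1 l2. m r * relation2 l1 l2 r) = 0}"

text \<open>The real vector space \<open>N\<close> tensor \<open>\<real>\<close>, as a set of cosets with the quotient topology.\<close>

definition ray_space :: "nat \<Rightarrow> nat \<Rightarrow> (ray \<Rightarrow> real) topology" where
  "ray_space l1 l2 = subtopology (powertop_real UNIV) {x. \<forall>r. r \<notin> rays l1 l2 \<longrightarrow> x r = 0}"

definition N_class :: "nat \<Rightarrow> nat \<Rightarrow> (nat \<Rightarrow> int) \<Rightarrow> (ray \<Rightarrow> real) \<Rightarrow> (ray \<Rightarrow> real) set" where
  "N_class l1 l2 c x =
     {\<lambda>r. x r + s * of_int (relation1 l1 l2 c r) + t * of_int (relation2 l1 l2 r) | s t. True}"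

definition N_space :: "nat \<Rightarrow> nat \<Rightarrow> (nat \<Rightarrow> int) \<Rightarrow> (ray \<Rightarrow> real) set topology" where
  "N_space l1 l2 c = topology (\<lambda>W.
     W \<subseteq> N_class l1 l2 c ` topspace (ray_space l1 l2) \<and>
     openin (ray_space l1 l2) {x \<in> topspace (ray_space l1 l2). N_class l1 l2 c x \<in> W})"

lemma openin_N_space:
  "openin (N_space l1 l2 c) W \<longleftrightarrow>
     W \<subseteq> N_class l1 l2 c ` topspace (ray_space l1 l2) \<and>
     openin (ray_space l1 l2) {x \<in> topspace (ray_space l1 l2). N_class l1 l2 c x \<in> W}"
proof -
  let ?X = "ray_space l1 l2" and ?q = "N_class l1 l2 c"
  have "istopology (\<lambda>W. W \<subseteq> ?q ` topspace ?X \<and> openin ?X {x \<in> topspace ?X. ?q x \<in> W})"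
    unfolding istopology_def
  proof (intro conjI allI impI)
    fix S T
    assume S: "S \<subseteq> ?q ` topspace ?X \<and> openin ?X {x \<in> topspace ?X. ?q x \<in> S}"
      and T: "T \<subseteq> ?q ` topspace ?X \<and> openin ?X {x \<in> topspace ?X. ?q x \<in> T}"
    show "S \<inter> T \<subseteq> ?q ` topspace ?X" using S by blast
    have "{x \<in> topspace ?X. ?q x \<in> S \<inter> T} =
        {x \<in> topspace ?X. ?q x \<in> S} \<inter> {x \<in> topspace ?X. ?q x \<in> T}" by blast
    then show "openin ?X {x \<in> topspace ?X. ?q x \<in> S \<inter> T}" using S T by auto
  next
    fix K
    assume K: "\<forall>S\<in>K. S \<subseteq> ?q ` topspace ?X \<and> openin ?X {x \<in> topspace ?X. ?q x \<in> S}"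
    show "\<Union>K \<subseteq> ?q ` topspace ?X" using K by blast
    have "{x \<in> topspace ?X. ?q x \<in> \<Union>K} = \<Union>((\<lambda>S. {x \<in> topspace ?X. ?q x \<in> S}) ` K)" by blast
    then show "openin ?X {x \<in> topspace ?X. ?q x \<in> \<Union>K}" using K by auto
  qed
  then show ?thesis by (simp add: N_space_def topology_inverse')
qed

lemma quotient_map_N_class: "quotient_map (ray_space l1 l2) (N_space l1 l2 c) (N_class l1 l2 c)"
proof -
  have "openin (N_space l1 l2 c) (N_class l1 l2 c ` topspace (ray_space l1 l2))"
  proof -
    have "{x \<in> topspace (ray_space l1 l2).
        N_class l1 l2 c x \<in> N_class l1 l2 c ` topspace (ray_space l1 l2)} = topspace (ray_space l1 l2)"
      by blast
    then show ?thesis by (simp add: openin_N_space)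
  qed
  then have "topspace (N_space l1 l2 c) = N_class l1 l2 c ` topspace (ray_space l1 l2)"
    by (meson openin_N_space openin_subset openin_topspace subset_antisym)
  then show ?thesis by (auto simp: quotient_map_def openin_N_space)
qed


section \<open>Tempting sets of rays and the sets of immaculate classes\<close>

text \<open>The points of \<open>conv(R \<inter> \<sigma>(1))\<close> are the classes of the weight vectors \<open>w\<close> below; in particular this
  hull is empty if \<open>R \<inter> \<sigma>(1)\<close> is.\<close>

definition V_gt :: "nat \<Rightarrow> nat \<Rightarrow> (nat \<Rightarrow> int) \<Rightarrow> ray set \<Rightarrow> (ray \<Rightarrow> real) set set" where
  "V_gt l1 l2 c R =
     {N_class l1 l2 c (\<lambda>r. t * w r) | t w.
        t > 0 \<and>
        (\<exists>S\<in>fan l1 l2. (\<forall>r. 0 \<le> w r) \<and> (\<forall>r. r \<notin> R \<inter> S \<longrightarrow> w r = 0) \<and> (\<Sum>r\<in>R \<inter> S. w r) = 1)}"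

definition tempting :: "'k::field itself \<Rightarrow> nat \<Rightarrow> nat \<Rightarrow> (nat \<Rightarrow> int) \<Rightarrow> ray set \<Rightarrow> bool" where
  "tempting k l1 l2 c R \<longleftrightarrow>
     R \<subseteq> rays l1 l2 \<and> \<not> acyclic_space k (subtopology (N_space l1 l2 c) (V_gt l1 l2 c R))"

definition maculate :: "nat \<Rightarrow> nat \<Rightarrow> (nat \<Rightarrow> int) \<Rightarrow> ray set \<Rightarrow> ('a::linordered_idom \<times> 'a) set" where
  "maculate l1 l2 c R =
     class_map l1 l2 c ` {a. (\<forall>r\<in>rays l1 l2 - R. 0 \<le> a r) \<and> (\<forall>r\<in>R. a r \<le> - 1)}"

definition Imm_int :: "'k::field itself \<Rightarrow> nat \<Rightarrow> nat \<Rightarrow> (nat \<Rightarrow> int) \<Rightarrow> (int \<times> int) set" where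
  "Imm_int k l1 l2 c = - (\<Union>R\<in>{R. tempting k l1 l2 c R}. maculate l1 l2 c R)"

definition Imm_real :: "'k::field itself \<Rightarrow> nat \<Rightarrow> nat \<Rightarrow> (nat \<Rightarrow> int) \<Rightarrow> (int \<times> int) set" where
  "Imm_real k l1 l2 c =
     {(x, y). (real_of_int x, real_of_int y) \<notin> (\<Union>R\<in>{R. tempting k l1 l2 c R}. maculate l1 l2 c R)}"


section \<open>Cohomology of line bundles\<close>

text \<open>The cohomology of \<open>\<O>(D)\<close>, for the torus invariant divisor \<open>D\<close> with coefficients \<open>a\<close>, is the Cech
  cohomology of the cover of the variety by the affine charts \<open>U\<^sub>\<sigma>\<close> of the maximal cones \<open>\<sigma>\<close>; it computes
  sheaf cohomology, since the variety is separated and the sheaf is quasi-coherent. The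
  intersection of the charts in a list \<open>I\<close> is the chart of the cone with ray set \<open>\<Inter>(set I)\<close>.
  A section over \<open>U\<^sub>\<sigma>\<close> is a Laurent polynomial, that is a finitely supported function \<open>s\<close> on the
  character lattice, all of whose exponents \<open>m\<close> satisfy \<open>m r \<ge> - a r\<close> for each ray \<open>r\<close> of
  \<open>\<sigma>\<close>. Cochains are indexed by all (not only increasing) tuples of charts; their values on
  other lists are irrelevant.\<close>

definition sections ::
    "nat \<Rightarrow> nat \<Rightarrow> (nat \<Rightarrow> int) \<Rightarrow> (ray \<Rightarrow> int) \<Rightarrow> ray set \<Rightarrow> ((ray \<Rightarrow> int) \<Rightarrow> 'k::field) set" where
  "sections l1 l2 c a S =
     {s. finite {m. s m \<noteq> 0} \<and>
         (\<forall>m. s m \<noteq> 0 \<longrightarrow> m \<in> char_lattice l1 l2 c \<and> (\<forall>r\<in>S. m r \<ge> - a r))}"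

definition chart_tuples :: "nat \<Rightarrow> nat \<Rightarrow> nat \<Rightarrow> ray set list set" where
  "chart_tuples l1 l2 p = {I. length I = Suc p \<and> set I \<subseteq> max_cones l1 l2}"

definition cech_cochains ::
    "nat \<Rightarrow> nat \<Rightarrow> (nat \<Rightarrow> int) \<Rightarrow> (ray \<Rightarrow> int) \<Rightarrow> nat
     \<Rightarrow> (ray set list \<Rightarrow> (ray \<Rightarrow> int) \<Rightarrow> 'k::field) set" where
  "cech_cochains l1 l2 c a p =
     {g. \<forall>I\<in>chart_tuples l1 l2 p. g I \<in> sections l1 l2 c a (\<Inter>(set I))}"

definition cech_coboundary ::
    "(ray set list \<Rightarrow> (ray \<Rightarrow> int) \<Rightarrow> 'k::field) \<Rightarrow> ray set list \<Rightarrow> (ray \<Rightarrow> int) \<Rightarrow> 'k" where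
  "cech_coboundary g I m = (\<Sum>i<length I. (- 1) ^ i * g (take i I @ drop (Suc i) I) m)"

definition cech_cohomology_vanishes ::
    "'k::field itself \<Rightarrow> nat \<Rightarrow> nat \<Rightarrow> (nat \<Rightarrow> int) \<Rightarrow> (ray \<Rightarrow> int) \<Rightarrow> nat \<Rightarrow> bool" where
  "cech_cohomology_vanishes _ l1 l2 c a p \<longleftrightarrow>
     (\<forall>g \<in> cech_cochains l1 l2 c a p :: (ray set list \<Rightarrow> (ray \<Rightarrow> int) \<Rightarrow> 'k) set.
        (\<forall>I\<in>chart_tuples l1 l2 (Suc p). \<forall>m. cech_coboundary g I m = 0) \<longrightarrow>
        (case p of
           0 \<Rightarrow> \<forall>I\<in>chart_tuples l1 l2 0. \<forall>m. g I m = 0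
         | Suc q \<Rightarrow> \<exists>h \<in> cech_cochains l1 l2 c a q :: (ray set list \<Rightarrow> (ray \<Rightarrow> int) \<Rightarrow> 'k) set.
                     \<forall>I\<in>chart_tuples l1 l2 p. \<forall>m. g I m = cech_coboundary h I m))"

text \<open>A class is immaculate if \<open>\<O>(D)\<close> is, for the divisors \<open>D\<close> in it; these are all isomorphic, and there
  is at least one because \<open>class_map\<close> is onto for \<open>l1, l2 \<ge> 1\<close>.\<close>

definition immaculate :: "'k::field itself \<Rightarrow> nat \<Rightarrow> nat \<Rightarrow> (nat \<Rightarrow> int) \<Rightarrow> int \<times> int \<Rightarrow> bool" where
  "immaculate k l1 l2 c L \<longleftrightarrow>
     (\<forall>a. class_map l1 l2 c a = L \<longrightarrow> (\<forall>p. cech_cohomology_vanishes k l1 l2 c a p))"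

end

theory Submission
  imports Defs
begin

text \<open>
Write \<open>U\<close> for the set of all rays \<open>u\<^sub>i\<close> and \<open>V\<close> for the set of all rays \<open>v\<^sub>j\<close>. Of all sets \<open>R\<close> of rays
only \<open>{}\<close>, \<open>U\<close>, \<open>V\<close> and \<open>U \<union> V\<close> matter, both for the tempting sets and for the cohomology of line
bundles, and for the same reason. A set of rays spans a cone of the fan if and only if it contains
neither \<open>U\<close> nor \<open>V\<close>. So the complex of those cones that have all their rays in \<open>R\<close> is the join of its
\<open>u\<close>-part and its \<open>v\<close>-part, and each part is a full simplex unless it belongs to a whole family, in
which case it is the boundary of a simplex. If \<open>R\<close> contains some but not all rays of one of the two
families, a factor of the join is a nonempty full simplex, and the join is contractible. The four
remaining sets give the empty complex and spheres.

For the tempting sets (\<open>tempting_iff_whole_family\<close>) this is made precise by coordinates: every point of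
\<open>N \<otimes> \<real>\<close> has exactly one representative whose smallest \<open>u\<close>-coordinate and smallest
\<open>v\<close>-coordinate are both zero (\<open>normalize\<close>), and in terms of these representatives \<open>V\<^sup>>(R)\<close> does not
depend on \<open>c\<close>. It is star-shaped around a ray of \<open>R\<close> in the contractible case, and homeomorphic to a
punctured Euclidean space if \<open>R\<close> is \<open>U\<close>, \<open>V\<close> or \<open>U \<union> V\<close>. Coning singular simplices from the centre
kills the cohomology of a star-shaped set (\<open>acyclic_space_star_shaped\<close>). A punctured Euclidean space
that is path connected has the homology of a sphere of positive dimension, and an infinite cyclic
integral homology group forces cohomology with coefficients in every field
(\<open>not_singular_cohomology_vanishes\<close>).

For line bundles (\<open>immaculate_iff_not_maculate\<close>) the Cech complex of \<open>\<O>(D)\<close> is a sum over the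
characters \<open>m\<close>. The summand of \<open>m\<close> consists of the cochains supported on those tuples of charts whose
intersection contains no ray of \<open>R = {r. a r + m r < 0}\<close>, where \<open>a\<close> are the coefficients of \<open>D\<close>. This
complex is exact if and only if \<open>R\<close> is not one of the four sets. As \<open>m\<close> runs through the characters,
\<open>a + m\<close> runs through all coefficient vectors of the class of \<open>D\<close>, so the class is immaculate if and only
if it avoids the maculate regions of the four sets.

Each of these regions is finally described by two inequalities. Every point that satisfies them comes
from a coefficient vector that is constant on each family up to a change at one ray of the family; as
this vector is given by the same formula over \<open>\<int>\<close> and over \<open>\<real>\<close>, the integral and the real regions
contain the same lattice points.
\<close>

section \<open>Cochains supported on avoiding tuples\<close>

definition tuple_coboundary :: "('v list \<Rightarrow> 'k::comm_ring_1) \<Rightarrow> 'v list \<Rightarrow> 'k" where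
  "tuple_coboundary g I = (\<Sum>i<length I. (- 1) ^ i * g (take i I @ drop (Suc i) I))"

lemma tuple_coboundary_Nil [simp]: "tuple_coboundary g [] = 0"
  by (simp add: tuple_coboundary_def)

lemma tuple_coboundary_Cons:
  "tuple_coboundary g (v # I) = g I - tuple_coboundary (\<lambda>J. g (v # J)) I"
  by (simp add: tuple_coboundary_def sum.lessThan_Suc_shift sum_negf del: sum.lessThan_Suc)

lemma tuple_coboundary_diff:
  "tuple_coboundary (\<lambda>I. f I - g I) I = tuple_coboundary f I - tuple_coboundary g I"
  by (simp add: tuple_coboundary_def algebra_simps sum_subtractf)

lemma tuple_coboundary_cong:
  assumes "set I \<subseteq> W" and "\<And>J. set J \<subseteq> W \<Longrightarrow> Suc (length J) = length I \<Longrightarrow> f J = g J"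
  shows "tuple_coboundary f I = tuple_coboundary g I"
  unfolding tuple_coboundary_def
proof (intro sum.cong refl arg_cong2[of _ _ _ _ "(*)"])
  fix i assume "i \<in> {..<length I}"
  then show "f (take i I @ drop (Suc i) I) = g (take i I @ drop (Suc i) I)"
    using assms set_take_subset[of i I] set_drop_subset[of "Suc i" I] by (intro assms(2)) auto
qed

text \<open>Instead of pairing off the terms with \<open>i < j\<close> and \<open>j < i\<close>, the induction uses that prepending a
vertex is a contracting homotopy of the complex of all tuples (\<open>tuple_coboundary_Cons\<close>).\<close>

lemma tuple_coboundary_coboundary: "tuple_coboundary (tuple_coboundary g) I = 0"
proof (induction I arbitrary: g)
  case (Cons v I)
  have "tuple_coboundary (tuple_coboundary g) (v # I) =
      tuple_coboundary g I - tuple_coboundary (\<lambda>J. g J - tuple_coboundary (\<lambda>J. g (v # J)) J) I"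
    by (simp add: tuple_coboundary_Cons)
  then show ?case
    by (simp add: tuple_coboundary_diff Cons.IH)
qed simp

text \<open>If \<open>W\<close> consists of the ray sets of some charts, these are the tuples of charts whose intersection
contains no ray of \<open>R\<close>. The empty tuple has the intersection \<open>UNIV\<close>, so it is avoiding only if \<open>R\<close> is
empty; in that case the complex of cochains on avoiding tuples is augmented.\<close>

definition avoiding_tuples :: "'r set set \<Rightarrow> 'r set \<Rightarrow> 'r set list set" where
  "avoiding_tuples W R = {I. set I \<subseteq> W \<and> R \<inter> \<Inter>(set I) = {}}"

text \<open>Exactness in all degrees at once: a cochain is a function on tuples of all lengths, that is a
sequence of cochains of the individual degrees, and the coboundary respects the degrees.\<close>

definition tuples_exact :: "'k::field itself \<Rightarrow> 'r set set \<Rightarrow> 'r set \<Rightarrow> bool" where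
  "tuples_exact _ W R \<longleftrightarrow>
     (\<forall>g :: 'r set list \<Rightarrow> 'k.
        (\<forall>I. g I \<noteq> 0 \<longrightarrow> I \<in> avoiding_tuples W R) \<longrightarrow>
        (\<forall>I. set I \<subseteq> W \<longrightarrow> tuple_coboundary g I = 0) \<longrightarrow>
        (\<exists>h :: 'r set list \<Rightarrow> 'k. (\<forall>I. h I \<noteq> 0 \<longrightarrow> I \<in> avoiding_tuples W R) \<and>
             (\<forall>I. set I \<subseteq> W \<longrightarrow> g I = tuple_coboundary h I)))"

lemma tuples_exactD:
  fixes g :: "'r set list \<Rightarrow> 'k::field"
  assumes "tuples_exact TYPE('k) W R" and "\<And>I. g I \<noteq> 0 \<Longrightarrow> I \<in> avoiding_tuples W R"
    and "\<And>I. set I \<subseteq> W \<Longrightarrow> tuple_coboundary g I = 0"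
  obtains h :: "'r set list \<Rightarrow> 'k" where "\<And>I. h I \<noteq> 0 \<Longrightarrow> I \<in> avoiding_tuples W R"
    and "\<And>I. set I \<subseteq> W \<Longrightarrow> g I = tuple_coboundary h I"
  using assms unfolding tuples_exact_def by blast

lemma tuples_exactI:
  assumes "\<And>g :: 'r set list \<Rightarrow> 'k::field.
      (\<And>I. g I \<noteq> 0 \<Longrightarrow> I \<in> avoiding_tuples W R) \<Longrightarrow>
      (\<And>I. set I \<subseteq> W \<Longrightarrow> tuple_coboundary g I = 0) \<Longrightarrow>
      \<exists>h :: 'r set list \<Rightarrow> 'k. (\<forall>I. h I \<noteq> 0 \<longrightarrow> I \<in> avoiding_tuples W R) \<and>
             (\<forall>I. set I \<subseteq> W \<longrightarrow> g I = tuple_coboundary h I)"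
  shows "tuples_exact TYPE('k) W R"
  using assms unfolding tuples_exact_def by blast

lemma avoiding_tuples_split:
  "avoiding_tuples W R = avoiding_tuples W (insert r R) \<union> avoiding_tuples {v \<in> W. r \<in> v} R"
  "avoiding_tuples W (insert r R) \<inter> {I. set I \<subseteq> {v \<in> W. r \<in> v}} = {}"
  by (auto simp: avoiding_tuples_def)

text \<open>Cochains supported on avoiding tuples form a complex, because inserting a chart into a tuple only
shrinks the intersection.\<close>

lemma avoiding_tuple_if_coboundary:
  assumes "tuple_coboundary g I \<noteq> 0" and "set I \<subseteq> W"
    and "\<And>J. g J \<noteq> 0 \<Longrightarrow> J \<in> avoiding_tuples W R"
  shows "I \<in> avoiding_tuples W R"
proof -
  from assms(1) obtain i where "(- 1) ^ i * g (take i I @ drop (Suc i) I) \<noteq> 0"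
    unfolding tuple_coboundary_def by (meson sum.not_neutral_contains_not_neutral)
  then have "take i I @ drop (Suc i) I \<in> avoiding_tuples W R"
    by (intro assms(3)) auto
  then show ?thesis
    using assms(2) set_take_subset[of i I] set_drop_subset[of "Suc i" I]
    by (fastforce simp: avoiding_tuples_def)
qed

text \<open>For a ray \<open>r\<close>, the tuples avoiding \<open>R\<close> split into those avoiding \<open>insert r R\<close> and those all of whose
charts contain \<open>r\<close>. So restriction of cochains gives a short exact sequence of complexes with the
complex of \<open>(W, insert r R)\<close> on the left, that of \<open>(W, R)\<close> in the middle and that of
\<open>({v \<in> W. r \<in> v}, R)\<close> on the right. This lemma and the next one are the two
consequences of its long exact cohomology sequence that the proof uses.\<close>

lemma tuples_exact_insert:
  assumes "tuples_exact TYPE('k::field) W R" and "tuples_exact TYPE('k) {v \<in> W. r \<in> v} R"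
  shows "tuples_exact TYPE('k) W (insert r R)"
proof (rule tuples_exactI)
  let ?W = "{v \<in> W. r \<in> v}"
  note split = avoiding_tuples_split[where W = W and R = R and r = r]
  fix g :: "'a set list \<Rightarrow> 'k"
  assume g: "\<And>I. g I \<noteq> 0 \<Longrightarrow> I \<in> avoiding_tuples W (insert r R)"
    and cocycle: "\<And>I. set I \<subseteq> W \<Longrightarrow> tuple_coboundary g I = 0"
  obtain h :: "'a set list \<Rightarrow> 'k" where h: "\<And>I. h I \<noteq> 0 \<Longrightarrow> I \<in> avoiding_tuples W R"
    and gh: "\<And>I. set I \<subseteq> W \<Longrightarrow> g I = tuple_coboundary h I"
    by (rule tuples_exactD[OF assms(1), of g]) (use g cocycle split in blast)+
  define h' where "h' I = (if set I \<subseteq> ?W then h I else 0)" for I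
  have h': "I \<in> avoiding_tuples ?W R" if "h' I \<noteq> 0" for I
    using that h[of I] by (auto simp: h'_def avoiding_tuples_def split: if_splits)
  have "tuple_coboundary h' I = 0" if "set I \<subseteq> ?W" for I
  proof -
    have "tuple_coboundary h' I = tuple_coboundary h I"
      by (rule tuple_coboundary_cong[OF that]) (simp add: h'_def)
    also have "\<dots> = g I" by (rule gh[symmetric]) (use that in blast)
    also have "\<dots> = 0" using that g[of I] split(2) by blast
    finally show ?thesis .
  qed
  then obtain k :: "'a set list \<Rightarrow> 'k" where k: "\<And>I. k I \<noteq> 0 \<Longrightarrow> I \<in> avoiding_tuples ?W R"
    and hk: "\<And>I. set I \<subseteq> ?W \<Longrightarrow> h' I = tuple_coboundary k I"
    using tuples_exactD[OF assms(2), of h'] h' by blast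
  define h'' where "h'' I = (if set I \<subseteq> W then h I - tuple_coboundary k I else 0)" for I
  have "I \<in> avoiding_tuples W (insert r R)" if "h'' I \<noteq> 0" for I
  proof -
    have I: "set I \<subseteq> W" "h I \<noteq> 0 \<or> tuple_coboundary k I \<noteq> 0"
      using that by (auto simp: h''_def split: if_splits)
    have "I \<in> avoiding_tuples W R"
      using I h avoiding_tuple_if_coboundary[of k I W R] k split(1) by blast
    moreover have "\<not> set I \<subseteq> ?W"
      using that I(1) hk[of I] by (auto simp: h''_def h'_def)
    ultimately show ?thesis by (auto simp: avoiding_tuples_def)
  qed
  moreover have "g I = tuple_coboundary h'' I" if "set I \<subseteq> W" for I
  proof -
    have "tuple_coboundary h'' I = tuple_coboundary (\<lambda>I. h I - tuple_coboundary k I) I"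
      by (rule tuple_coboundary_cong[OF that]) (simp add: h''_def)
    then show ?thesis
      using gh[OF that] by (simp add: tuple_coboundary_diff tuple_coboundary_coboundary)
  qed
  ultimately show "\<exists>h. (\<forall>I. h I \<noteq> 0 \<longrightarrow> I \<in> avoiding_tuples W (insert r R)) \<and>
      (\<forall>I. set I \<subseteq> W \<longrightarrow> g I = tuple_coboundary h I)" by blast
qed

lemma tuples_exact_link:
  assumes "tuples_exact TYPE('k::field) W (insert r R)" and "tuples_exact TYPE('k) W R"
  shows "tuples_exact TYPE('k) {v \<in> W. r \<in> v} R"
proof (rule tuples_exactI)
  let ?W = "{v \<in> W. r \<in> v}"
  note split = avoiding_tuples_split[where W = W and R = R and r = r]
  fix g :: "'a set list \<Rightarrow> 'k"
  assume g: "\<And>I. g I \<noteq> 0 \<Longrightarrow> I \<in> avoiding_tuples ?W R"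
    and cocycle: "\<And>I. set I \<subseteq> ?W \<Longrightarrow> tuple_coboundary g I = 0"
  define f where "f I = (if set I \<subseteq> W then tuple_coboundary g I else 0)" for I
  have "I \<in> avoiding_tuples W (insert r R)" if "f I \<noteq> 0" for I
  proof -
    have "set I \<subseteq> W" "tuple_coboundary g I \<noteq> 0"
      using that by (auto simp: f_def split: if_splits)
    then have "I \<in> avoiding_tuples W R" "\<not> set I \<subseteq> ?W"
      using avoiding_tuple_if_coboundary[of g I W R] g split(1) cocycle by blast+
    then show ?thesis by (auto simp: avoiding_tuples_def)
  qed
  moreover have "tuple_coboundary f I = 0" if "set I \<subseteq> W" for I
    using tuple_coboundary_cong[OF that, of f "tuple_coboundary g"]
    by (simp add: f_def tuple_coboundary_coboundary)
  ultimately obtain h :: "'a set list \<Rightarrow> 'k"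
    where h: "\<And>I. h I \<noteq> 0 \<Longrightarrow> I \<in> avoiding_tuples W (insert r R)"
      and fh: "\<And>I. set I \<subseteq> W \<Longrightarrow> f I = tuple_coboundary h I"
    using tuples_exactD[OF assms(1), of f] by blast
  have "I \<in> avoiding_tuples W R" if "g I - h I \<noteq> 0" for I
    using that g[of I] h[of I] split(1) by fastforce
  moreover have "tuple_coboundary (\<lambda>I. g I - h I) I = 0" if "set I \<subseteq> W" for I
    using that fh[OF that] by (simp add: tuple_coboundary_diff f_def)
  ultimately obtain k :: "'a set list \<Rightarrow> 'k"
    where k: "\<And>I. k I \<noteq> 0 \<Longrightarrow> I \<in> avoiding_tuples W R"
      and ghk: "\<And>I. set I \<subseteq> W \<Longrightarrow> g I - h I = tuple_coboundary k I"
    using tuples_exactD[OF assms(2), of "\<lambda>I. g I - h I"] by blast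
  define k' where "k' I = (if set I \<subseteq> ?W then k I else 0)" for I
  have "I \<in> avoiding_tuples ?W R" if "k' I \<noteq> 0" for I
    using that k[of I] by (auto simp: k'_def avoiding_tuples_def split: if_splits)
  moreover have "g I = tuple_coboundary k' I" if "set I \<subseteq> ?W" for I
  proof -
    have "h I = 0" using h[of I] that split(2) by blast
    moreover have "tuple_coboundary k' I = tuple_coboundary k I"
      by (rule tuple_coboundary_cong[OF that]) (simp add: k'_def)
    ultimately show ?thesis using ghk[of I] that by auto
  qed
  ultimately show "\<exists>h. (\<forall>I. h I \<noteq> 0 \<longrightarrow> I \<in> avoiding_tuples ?W R) \<and>
      (\<forall>I. set I \<subseteq> ?W \<longrightarrow> g I = tuple_coboundary h I)" by blast
qed

lemma tuples_exact_cone: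
  assumes "W \<noteq> {}"
  shows "tuples_exact TYPE('k::field) W {}"
proof (rule tuples_exactI)
  from assms obtain v where v: "v \<in> W" by blast
  fix g :: "'a set list \<Rightarrow> 'k"
  assume g: "\<And>I. g I \<noteq> 0 \<Longrightarrow> I \<in> avoiding_tuples W {}"
    and cocycle: "\<And>I. set I \<subseteq> W \<Longrightarrow> tuple_coboundary g I = 0"
  have "I \<in> avoiding_tuples W {}" if "g (v # I) \<noteq> 0" for I
    using g[OF that] by (simp add: avoiding_tuples_def)
  moreover have "g I = tuple_coboundary (\<lambda>I. g (v # I)) I" if "set I \<subseteq> W" for I
    using cocycle[of "v # I"] that v by (simp add: tuple_coboundary_Cons)
  ultimately show "\<exists>h. (\<forall>I. h I \<noteq> 0 \<longrightarrow> I \<in> avoiding_tuples W {}) \<and>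
      (\<forall>I. set I \<subseteq> W \<longrightarrow> g I = tuple_coboundary h I)"
    by (intro exI[of _ "\<lambda>I. g (v # I)"]) blast
qed

lemma tuples_exact_no_vertices:
  assumes "R \<noteq> {}"
  shows "tuples_exact TYPE('k::field) {} R"
proof (rule tuples_exactI)
  fix g :: "'a set list \<Rightarrow> 'k"
  assume "\<And>I. g I \<noteq> 0 \<Longrightarrow> I \<in> avoiding_tuples {} R"
  then have "g I = 0" for I using assms by (force simp: avoiding_tuples_def)
  then show "\<exists>h. (\<forall>I. h I \<noteq> 0 \<longrightarrow> I \<in> avoiding_tuples {} R) \<and>
      (\<forall>I. set I \<subseteq> {} \<longrightarrow> g I = tuple_coboundary h I)"
    by (intro exI[of _ "\<lambda>_. 0"]) (simp add: tuple_coboundary_def)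
qed

lemma tuples_exact_face:
  assumes "finite A" and "v \<in> W" and "A \<subseteq> v"
  shows "tuples_exact TYPE('k::field) W A"
  using assms
proof (induction A arbitrary: W rule: finite_induct)
  case empty
  then show ?case by (auto intro: tuples_exact_cone)
next
  case (insert a A)
  then show ?case by (intro tuples_exact_insert insert.IH) auto
qed

text \<open>In the application, \<open>A\<close> is a nonempty part of one family of rays that is not the whole family, so
that adding \<open>A\<close> to a set of rays of the other family preserves being a cone. The rays of \<open>B\<close> are
inserted one at a time; the link of a ray of \<open>B\<close> inherits the hypothesis.\<close>

lemma tuples_exact_join_face:
  assumes "finite A" and "A \<noteq> {}" and "finite B"
    and "\<And>S v. S \<subseteq> B \<Longrightarrow> v \<in> W \<Longrightarrow> S \<subseteq> v \<Longrightarrow> \<exists>w\<in>W. S \<union> A \<subseteq> w"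
  shows "tuples_exact TYPE('k::field) W (A \<union> B)"
  using assms(3,4)
proof (induction B arbitrary: W rule: finite_induct)
  case empty
  show ?case
  proof (cases "W = {}")
    case False
    then obtain w where "w \<in> W" "A \<subseteq> w" using empty[of "{}"] by blast
    then show ?thesis using tuples_exact_face assms(1) by auto
  qed (simp add: assms(2) tuples_exact_no_vertices)
next
  case (insert b B)
  have "tuples_exact TYPE('k) W (A \<union> B)"
    using insert.prems by (intro insert.IH) (meson subset_insertI2)
  moreover have "tuples_exact TYPE('k) {v \<in> W. b \<in> v} (A \<union> B)"
  proof (rule insert.IH)
    fix S v assume "S \<subseteq> B" "v \<in> {v \<in> W. b \<in> v}" "S \<subseteq> v"
    then have "\<exists>w\<in>W. insert b S \<union> A \<subseteq> w" by (intro insert.prems[of _ v]) auto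
    then show "\<exists>w\<in>{v \<in> W. b \<in> v}. S \<union> A \<subseteq> w" by auto
  qed
  ultimately show ?case by (simp add: tuples_exact_insert)
qed

text \<open>A minimal nonface is the boundary of a simplex, hence a sphere. Passing to the link of
one of its vertices after the other lowers the dimension until no chart is left; then
the empty tuple carries a cocycle that is not a coboundary.\<close>

lemma not_tuples_exact_minimal_nonface:
  assumes "finite R" and "\<And>r. r \<in> R \<Longrightarrow> \<exists>v\<in>W. R - {r} \<subseteq> v" and "\<not> (\<exists>v\<in>W. R \<subseteq> v)"
  shows "\<not> tuples_exact TYPE('k::field) W R"
  using assms
proof (induction R arbitrary: W rule: finite_induct)
  case empty
  show ?case
  proof
    assume "tuples_exact TYPE('k) W {}"
    moreover define g :: "'a set list \<Rightarrow> 'k" where "g I = (if I = [] then 1 else 0)" for I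
    moreover have W: "W = {}" using empty.prems(2) by auto
    moreover have "I \<in> avoiding_tuples W {}" if "g I \<noteq> 0" for I
      using that by (simp add: g_def avoiding_tuples_def split: if_splits)
    moreover have "tuple_coboundary g I = 0" if "set I \<subseteq> W" for I
      using that W by simp
    ultimately obtain h :: "'a set list \<Rightarrow> 'k" where "\<And>I. set I \<subseteq> W \<Longrightarrow> g I = tuple_coboundary h I"
      using tuples_exactD[of W "{}" g] by metis
    from this[of "[]"] show False by (simp add: g_def)
  qed
next
  case (insert r R)
  obtain v where v: "v \<in> W" "R \<subseteq> v" using insert.prems(1)[of r] insert.hyps(2) by auto
  have "\<not> tuples_exact TYPE('k) {v \<in> W. r \<in> v} R"
  proof (rule insert.IH)
    fix s assume "s \<in> R"
    then show "\<exists>v\<in>{v \<in> W. r \<in> v}. R - {s} \<subseteq> v"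
    proof -
      obtain v where v: "v \<in> W" "insert r R - {s} \<subseteq> v" using insert.prems(1)[of s] \<open>s \<in> R\<close> by blast
      moreover have "r \<in> insert r R - {s}" using \<open>s \<in> R\<close> insert.hyps(2) by blast
      ultimately show ?thesis by blast
    qed
  next
    show "\<not> (\<exists>v\<in>{v \<in> W. r \<in> v}. R \<subseteq> v)" using insert.prems(2) by simp
  qed
  then show ?case using tuples_exact_link[of W r R] tuples_exact_face[OF insert.hyps(1) v] by metis
qed

text \<open>The join of the boundaries of the simplices \<open>A\<close> and \<open>B\<close> is again a sphere. As long as \<open>B\<close> has another
ray, removing a ray \<open>b\<close> from it leaves an exact complex, so exactness would pass to the link of \<open>b\<close>, which is
a join of the same kind with a smaller \<open>B\<close>.\<close>

lemma not_tuples_exact_join: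
  assumes "finite A" and "A \<noteq> {}" and "finite B" and "B \<noteq> {}" and "A \<inter> B = {}"
    and "(\<lambda>v. v \<inter> (A \<union> B)) ` W = {A \<union> B - {a, b} | a b. a \<in> A \<and> b \<in> B}"
  shows "\<not> tuples_exact TYPE('k::field) W (A \<union> B)"
  using assms(3-)
proof (induction B arbitrary: W rule: finite_ne_induct)
  case (singleton b)
  \<comment> \<open>Every vertex misses \<open>b\<close>, so \<open>b\<close> adds no condition to the one that \<open>A\<close> imposes on nonempty tuples.\<close>
  have W: "\<exists>a\<in>A. v \<inter> (A \<union> {b}) = A - {a}" if "v \<in> W" for v
  proof -
    have "v \<inter> (A \<union> {b}) \<in> (\<lambda>v. v \<inter> (A \<union> {b})) ` W" using that by blast
    then obtain a where "a \<in> A" "v \<inter> (A \<union> {b}) = A \<union> {b} - {a, b}"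
      unfolding singleton.prems(2) by blast
    then show ?thesis using singleton.prems(1) by (intro bexI[of _ a]) blast+
  qed
  have b: "b \<notin> v" if "v \<in> W" for v
    using W[OF that] singleton.prems(1) by blast
  have eq: "I \<in> avoiding_tuples W (A \<union> {b}) \<longleftrightarrow> I \<in> avoiding_tuples W A" for I
  proof (cases I)
    case Nil
    then show ?thesis using \<open>A \<noteq> {}\<close> by (simp add: avoiding_tuples_def)
  next
    case (Cons v J)
    then show ?thesis using b[of v] by (auto simp: avoiding_tuples_def)
  qed
  moreover have "\<not> tuples_exact TYPE('k) W A"
  proof (rule not_tuples_exact_minimal_nonface[OF assms(1)])
    fix a assume "a \<in> A"
    then have "A \<union> {b} - {a, b} \<in> (\<lambda>v. v \<inter> (A \<union> {b})) ` W" unfolding singleton.prems(2) by blast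
    then obtain v where v: "v \<in> W" "A \<union> {b} - {a, b} = v \<inter> (A \<union> {b})" by blast
    have "A - {a} \<subseteq> A \<union> {b} - {a, b}" using singleton.prems(1) by blast
    then have "A - {a} \<subseteq> v" unfolding v(2) by blast
    then show "\<exists>v\<in>W. A - {a} \<subseteq> v" using v(1) by blast
  next
    show "\<not> (\<exists>v\<in>W. A \<subseteq> v)"
    proof
      assume "\<exists>v\<in>W. A \<subseteq> v"
      then obtain v where v: "v \<in> W" "A \<subseteq> v" by blast
      from W[OF v(1)] show False using v(2) by blast
    qed
  qed
  moreover have "avoiding_tuples W (A \<union> {b}) = avoiding_tuples W A"
    by (rule Set.set_eqI) (rule eq)
  ultimately show ?case unfolding tuples_exact_def by simp
next
  case (insert b B)
  have W: "\<exists>a\<in>A. \<exists>c\<in>insert b B. v \<inter> (A \<union> insert b B) = A \<union> insert b B - {a, c}" if "v \<in> W" for v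
  proof -
    have "v \<inter> (A \<union> insert b B) \<in> (\<lambda>v. v \<inter> (A \<union> insert b B)) ` W" using that by blast
    then show ?thesis unfolding insert.prems(2) by blast
  qed
  have W': "\<exists>v\<in>W. v \<inter> (A \<union> insert b B) = A \<union> insert b B - {a, c}"
    if "a \<in> A" "c \<in> insert b B" for a c
  proof -
    have "A \<union> insert b B - {a, c} \<in> (\<lambda>v. v \<inter> (A \<union> insert b B)) ` W"
      unfolding insert.prems(2) using that by blast
    then show ?thesis by (elim imageE) (rule bexI, erule sym)
  qed
  have b: "b \<notin> A" "b \<notin> B" using insert.hyps insert.prems(1) by auto
  have "tuples_exact TYPE('k) W (B \<union> A)"
  proof (rule tuples_exact_join_face)
    fix S v assume S: "S \<subseteq> A" "v \<in> W" "S \<subseteq> v"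
    obtain a c where ac: "a \<in> A" "c \<in> insert b B" "v \<inter> (A \<union> insert b B) = A \<union> insert b B - {a, c}"
      using W[OF S(2)] by blast
    obtain w where "w \<in> W" "w \<inter> (A \<union> insert b B) = A \<union> insert b B - {a, b}"
      using W'[OF ac(1), of b] by blast
    moreover have "a \<notin> v" using ac by blast
    then have "a \<notin> S" "a \<notin> B" using S(3) ac(1) insert.prems(1) by blast+
    then have "S \<union> B \<subseteq> A \<union> insert b B - {a, b}" using S(1) b by blast
    ultimately show "\<exists>w\<in>W. S \<union> B \<subseteq> w" by blast
  qed (use insert assms in auto)
  moreover have "\<not> tuples_exact TYPE('k) {v \<in> W. b \<in> v} (A \<union> B)"
  proof (rule insert.IH)
    show "A \<inter> B = {}" using insert.prems(1) by blast
    show "(\<lambda>v. v \<inter> (A \<union> B)) ` {v \<in> W. b \<in> v} = {A \<union> B - {a, b} | a b. a \<in> A \<and> b \<in> B}"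
    proof (intro equalityI subsetI)
      fix u assume "u \<in> (\<lambda>v. v \<inter> (A \<union> B)) ` {v \<in> W. b \<in> v}"
      then obtain v where v: "v \<in> W" "b \<in> v" "u = v \<inter> (A \<union> B)" by blast
      obtain a c where ac: "a \<in> A" "c \<in> insert b B" "v \<inter> (A \<union> insert b B) = A \<union> insert b B - {a, c}"
        using W[OF v(1)] by blast
      have "c \<noteq> b" using v(2) ac(3) by blast
      moreover have "u = (A \<union> insert b B - {a, c}) \<inter> (A \<union> B)" unfolding ac(3)[symmetric] v(3) by blast
      moreover have "(A \<union> insert b B - {a, c}) \<inter> (A \<union> B) = A \<union> B - {a, c}"
        using b by blast
      ultimately show "u \<in> {A \<union> B - {a, b} | a b. a \<in> A \<and> b \<in> B}" using ac(1,2) by blast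
    next
      fix u assume "u \<in> {A \<union> B - {a, b} | a b. a \<in> A \<and> b \<in> B}"
      then obtain a c where ac: "a \<in> A" "c \<in> B" "u = A \<union> B - {a, c}" by blast
      then obtain v where v: "v \<in> W" "v \<inter> (A \<union> insert b B) = A \<union> insert b B - {a, c}"
        using W'[of a c] by blast
      have "b \<in> A \<union> insert b B - {a, c}" using ac(1,2) b by blast
      then have "b \<in> v" unfolding v(2)[symmetric] by blast
      moreover have "v \<inter> (A \<union> B) = (A \<union> insert b B - {a, c}) \<inter> (A \<union> B)" unfolding v(2)[symmetric] by blast
      moreover have "(A \<union> insert b B - {a, c}) \<inter> (A \<union> B) = A \<union> B - {a, c}"
        using b by blast
      ultimately show "u \<in> (\<lambda>v. v \<inter> (A \<union> B)) ` {v \<in> W. b \<in> v}" using v(1) ac(3) by blast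
    qed
  qed
  ultimately show ?case
    using tuples_exact_link[of W b "A \<union> B"] unfolding Un_insert_right Un_commute[of B A] by blast
qed

section \<open>The Cech complex of a line bundle\<close>

definition whole_families :: "nat \<Rightarrow> nat \<Rightarrow> ray set set" where
  "whole_families l1 l2 = {{}, URay ` {1..l1}, VRay ` {1..l2}, rays l1 l2}"

lemma finite_rays [simp]: "finite (rays l1 l2)"
  by (simp add: rays_def)

lemma max_cones_eq:
  "max_cones l1 l2 =
     {rays l1 l2 - {u, v} | u v. u \<in> URay ` {1..l1} \<and> v \<in> VRay ` {1..l2}}"
  unfolding max_cones_def by blast

lemma max_cones_subset_rays: "S \<in> max_cones l1 l2 \<Longrightarrow> S \<subseteq> rays l1 l2"
  unfolding max_cones_def by blast

lemma finite_max_cones [simp]: "finite (max_cones l1 l2)"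
  by (rule finite_subset[of _ "Pow (rays l1 l2)"]) (auto dest: max_cones_subset_rays)

lemma tuples_exact_max_cones:
  assumes "R \<subseteq> rays l1 l2" and "R \<notin> whole_families l1 l2"
  shows "tuples_exact TYPE('k::field) (max_cones l1 l2) R"
proof -
  define U V where "U = URay ` {1..l1}" and "V = VRay ` {1..l2}"
  have UV: "rays l1 l2 = U \<union> V" "U \<inter> V = {}" by (auto simp: U_def V_def rays_def)
  have cones: "max_cones l1 l2 = {U \<union> V - {u, v} | u v. u \<in> U \<and> v \<in> V}"
    unfolding max_cones_eq UV(1) U_def V_def ..
  have fin: "finite (R \<inter> U)" "finite (R \<inter> V)" by (simp_all add: U_def V_def)
  have R: "R = (R \<inter> U) \<union> (R \<inter> V)" using assms(1) UV(1) by blast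
  have "R \<noteq> {}" "R \<noteq> U" "R \<noteq> V" "R \<noteq> U \<union> V"
    using assms(2) by (auto simp: whole_families_def U_def V_def rays_def)
  then consider u where "u \<in> U" "u \<notin> R" "R \<inter> U \<noteq> {}" | v where "v \<in> V" "v \<notin> R" "R \<inter> V \<noteq> {}"
  proof (cases "R \<inter> U = {} \<or> U \<subseteq> R")
    case True
    then have "R \<inter> V \<noteq> {}" "\<not> V \<subseteq> R"
      using \<open>R \<noteq> {}\<close> \<open>R \<noteq> U\<close> \<open>R \<noteq> V\<close> \<open>R \<noteq> U \<union> V\<close> R by auto
    then show thesis using that(2) by blast
  next
    case False
    then show thesis using that(1) by blast
  qed
  then show ?thesis
  proof cases
    case 1
    have "tuples_exact TYPE('k) (max_cones l1 l2) ((R \<inter> U) \<union> (R \<inter> V))"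
    proof (rule tuples_exact_join_face[OF fin(1) 1(3) fin(2)])
      fix S w assume S: "S \<subseteq> R \<inter> V" "w \<in> max_cones l1 l2" "S \<subseteq> w"
      then obtain u' v where v: "v \<in> V" "w = U \<union> V - {u', v}" unfolding cones by blast
      have "U \<union> V - {u, v} \<in> max_cones l1 l2" unfolding cones using 1(1) v(1) by blast
      moreover have "S \<union> R \<inter> U \<subseteq> U \<union> V - {u, v}" using S v 1 UV(2) by blast
      ultimately show "\<exists>w\<in>max_cones l1 l2. S \<union> R \<inter> U \<subseteq> w" by blast
    qed
    then show ?thesis using R by simp
  next
    case 2
    have "tuples_exact TYPE('k) (max_cones l1 l2) ((R \<inter> V) \<union> (R \<inter> U))"
    proof (rule tuples_exact_join_face[OF fin(2) 2(3) fin(1)])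
      fix S w assume S: "S \<subseteq> R \<inter> U" "w \<in> max_cones l1 l2" "S \<subseteq> w"
      then obtain u v' where u: "u \<in> U" "w = U \<union> V - {u, v'}" unfolding cones by blast
      have "U \<union> V - {u, v} \<in> max_cones l1 l2" unfolding cones using 2(1) u(1) by blast
      moreover have "S \<union> R \<inter> V \<subseteq> U \<union> V - {u, v}" using S u 2 UV(2) by blast
      ultimately show "\<exists>w\<in>max_cones l1 l2. S \<union> R \<inter> V \<subseteq> w" by blast
    qed
    then show ?thesis using R by (simp add: Un_commute)
  qed
qed

lemma not_tuples_exact_max_cones:
  assumes "l1 \<ge> 1" and "l2 \<ge> 1" and "R \<in> whole_families l1 l2" and "R \<noteq> {}"
  shows "\<not> tuples_exact TYPE('k::field) (max_cones l1 l2) R"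
proof -
  define U V where "U = URay ` {1..l1}" and "V = VRay ` {1..l2}"
  have UV: "rays l1 l2 = U \<union> V" "U \<inter> V = {}" by (auto simp: U_def V_def rays_def)
  have cones: "max_cones l1 l2 = {U \<union> V - {u, v} | u v. u \<in> U \<and> v \<in> V}"
    unfolding max_cones_eq UV(1) U_def V_def ..
  have fin: "finite U" "finite V" by (simp_all add: U_def V_def)
  have ne: "U \<noteq> {}" "V \<noteq> {}" using assms(1,2) by (simp_all add: U_def V_def)
  have cone: "U \<union> V - {u, v} \<in> max_cones l1 l2" if "u \<in> U" "v \<in> V" for u v
    unfolding cones using that by blast
  consider "R = U" | "R = V" | "R = U \<union> V"
    using assms(3,4) UV(1) by (auto simp: whole_families_def U_def V_def)
  then show ?thesis
  proof cases
    case 1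
    obtain v where v: "v \<in> V" using ne by blast
    show ?thesis unfolding 1
    proof (rule not_tuples_exact_minimal_nonface[OF fin(1)])
      fix u assume "u \<in> U"
      then show "\<exists>w\<in>max_cones l1 l2. U - {u} \<subseteq> w"
        using v UV(2) by (intro bexI[OF _ cone[of u v]]) auto
    next
      show "\<not> (\<exists>w\<in>max_cones l1 l2. U \<subseteq> w)" unfolding cones by blast
    qed
  next
    case 2
    obtain u where u: "u \<in> U" using ne by blast
    show ?thesis unfolding 2
    proof (rule not_tuples_exact_minimal_nonface[OF fin(2)])
      fix v assume "v \<in> V"
      then show "\<exists>w\<in>max_cones l1 l2. V - {v} \<subseteq> w"
        using u UV(2) by (intro bexI[OF _ cone[of u v]]) auto
    next
      show "\<not> (\<exists>w\<in>max_cones l1 l2. V \<subseteq> w)" unfolding cones by blast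
    qed
  next
    case 3
    have "w \<inter> (U \<union> V) = w" if "w \<in> max_cones l1 l2" for w using that unfolding cones by blast
    then have "(\<lambda>w. w \<inter> (U \<union> V)) ` max_cones l1 l2 = max_cones l1 l2" by simp
    then show ?thesis unfolding 3
      by (intro not_tuples_exact_join fin ne UV(2)) (simp only: cones)
  qed
qed

lemma class_map_eq_sum_rays:
  "class_map l1 l2 c a =
     (\<Sum>r\<in>rays l1 l2. a r * of_int (relation1 l1 l2 c r),
      \<Sum>r\<in>rays l1 l2. a r * of_int (relation2 l1 l2 r))"
proof -
  have sum_rays: "(\<Sum>r\<in>rays l1 l2. f r) = (\<Sum>i=1..l1. f (URay i)) + (\<Sum>j=1..l2. f (VRay j))"
    for f :: "ray \<Rightarrow> 'a"
  proof -
    have "(\<Sum>r\<in>rays l1 l2. f r) = sum f (URay ` {1..l1}) + sum f (VRay ` {1..l2})"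
      unfolding rays_def by (rule sum.union_disjoint) auto
    also have "sum f (URay ` {1..l1}) = (\<Sum>i=1..l1. f (URay i))"
      by (subst sum.reindex) (auto simp: inj_on_def)
    also have "sum f (VRay ` {1..l2}) = (\<Sum>j=1..l2. f (VRay j))"
      by (subst sum.reindex) (auto simp: inj_on_def)
    finally show ?thesis .
  qed
  have "(\<Sum>r\<in>rays l1 l2. a r * of_int (relation1 l1 l2 c r)) =
      (\<Sum>i=1..l1. a (URay i)) + (\<Sum>j=1..l2. of_int (c j) * a (VRay j))"
    unfolding sum_rays
    by (intro arg_cong2[of _ _ _ _ "(+)"] sum.cong) (auto simp: relation1_def rays_def)
  moreover have "(\<Sum>r\<in>rays l1 l2. a r * of_int (relation2 l1 l2 r)) = (\<Sum>j=1..l2. a (VRay j))"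
  proof -
    have "(\<Sum>i=1..l1. a (URay i) * of_int (relation2 l1 l2 (URay i))) = 0"
      by (intro sum.neutral) (auto simp: relation2_def rays_def)
    moreover have "(\<Sum>j=1..l2. a (VRay j) * of_int (relation2 l1 l2 (VRay j))) = (\<Sum>j=1..l2. a (VRay j))"
      by (intro sum.cong) (auto simp: relation2_def rays_def)
    ultimately show ?thesis unfolding sum_rays by simp
  qed
  ultimately show ?thesis by (simp add: class_map_def)
qed

text \<open>Characters are the linear forms that vanish on both relations, and the class map evaluates a
coefficient vector at these relations; so \<open>a\<close> and \<open>a + m\<close> represent the same class.\<close>

lemma class_map_add_character:
  assumes "m \<in> char_lattice l1 l2 c"
  shows "class_map l1 l2 c (\<lambda>r. a r + m r) = class_map l1 l2 c a"
  using assms by (simp add: class_map_eq_sum_rays char_lattice_def distrib_right sum.distrib)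

lemma cech_coboundary_eq: "cech_coboundary g I m = tuple_coboundary (\<lambda>J. g J m) I"
  by (simp add: cech_coboundary_def tuple_coboundary_def)

lemma tuple_coboundary_zero [simp]: "tuple_coboundary (\<lambda>_. 0) I = 0"
  by (simp add: tuple_coboundary_def)

text \<open>A cocycle splits into its components at the individual characters \<open>m\<close>, and each of them is a coboundary
by exactness for the set \<open>Neg m\<close>. Only the finitely many characters that occur in the cocycle
contribute, so the primitives add up to Laurent polynomials again.\<close>

lemma cech_cohomology_vanishes_if_not_maculate:
  fixes L :: "int \<times> int"
  assumes notin: "\<And>R. R \<in> whole_families l1 l2 \<Longrightarrow> L \<notin> maculate l1 l2 c R"
    and a: "class_map l1 l2 c a = L"
  shows "cech_cohomology_vanishes TYPE('k::field) l1 l2 c a p"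
  unfolding cech_cohomology_vanishes_def
proof (intro ballI impI)
  let ?W = "max_cones l1 l2"
  define Neg where "Neg m = {r \<in> rays l1 l2. a r + m r \<le> - 1}" for m
  have Neg: "Neg m \<subseteq> rays l1 l2" "Neg m \<notin> whole_families l1 l2" if "m \<in> char_lattice l1 l2 c" for m
  proof -
    have "class_map l1 l2 c (\<lambda>r. a r + m r) \<in> maculate l1 l2 c (Neg m)"
      unfolding maculate_def by (intro imageI CollectI) (auto simp: Neg_def)
    then show "Neg m \<notin> whole_families l1 l2"
      using notin[of "Neg m"] class_map_add_character[OF that, of a] a by auto
  qed (auto simp: Neg_def)
  fix g :: "ray set list \<Rightarrow> (ray \<Rightarrow> int) \<Rightarrow> 'k"
  assume g: "g \<in> cech_cochains l1 l2 c a p"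
    and cocycle: "\<forall>I\<in>chart_tuples l1 l2 (Suc p). \<forall>m. cech_coboundary g I m = 0"
  have g_lattice: "m \<in> char_lattice l1 l2 c" if "I \<in> chart_tuples l1 l2 p" "g I m \<noteq> 0" for I m
    using that g by (auto simp: cech_cochains_def sections_def)
  define G where "G m I = (if I \<in> chart_tuples l1 l2 p then g I m else 0)" for m I
  have "\<exists>h. (\<forall>I. h I \<noteq> 0 \<longrightarrow> I \<in> avoiding_tuples ?W (Neg m)) \<and>
      (\<forall>I. set I \<subseteq> ?W \<longrightarrow> G m I = tuple_coboundary h I)" if m: "m \<in> char_lattice l1 l2 c" for m
  proof -
    have "I \<in> avoiding_tuples ?W (Neg m)" if "G m I \<noteq> 0" for I
    proof -
      have I: "I \<in> chart_tuples l1 l2 p" "g I m \<noteq> 0" using that by (auto simp: G_def split: if_splits)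
      then have "\<forall>r\<in>\<Inter>(set I). m r \<ge> - a r"
        using g by (auto simp: cech_cochains_def sections_def)
      then have "r \<notin> Neg m" if "r \<in> \<Inter>(set I)" for r
        using that unfolding Neg_def by (smt (verit) mem_Collect_eq)
      then have "Neg m \<inter> \<Inter>(set I) = {}" by blast
      then show ?thesis using I(1) by (simp add: avoiding_tuples_def chart_tuples_def)
    qed
    moreover have "tuple_coboundary (G m) I = 0" if "set I \<subseteq> ?W" for I
    proof (cases "length I = Suc (Suc p)")
      case True
      have "tuple_coboundary (G m) I = tuple_coboundary (\<lambda>J. g J m) I"
        by (rule tuple_coboundary_cong[OF that]) (use True in \<open>simp add: G_def chart_tuples_def\<close>)
      then show ?thesis using cocycle that True by (simp add: cech_coboundary_eq chart_tuples_def)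
    next
      case False
      have "tuple_coboundary (G m) I = tuple_coboundary (\<lambda>_. 0) I"
        by (rule tuple_coboundary_cong[OF that]) (use False in \<open>simp add: G_def chart_tuples_def\<close>)
      then show ?thesis by simp
    qed
    ultimately show ?thesis
      using tuples_exactD[OF tuples_exact_max_cones[OF Neg[OF m]], of "G m"] by metis
  qed
  then obtain H where
    H: "\<And>m I. m \<in> char_lattice l1 l2 c \<Longrightarrow> H m I \<noteq> 0 \<Longrightarrow> I \<in> avoiding_tuples ?W (Neg m)" and
    GH: "\<And>m I. m \<in> char_lattice l1 l2 c \<Longrightarrow> set I \<subseteq> ?W \<Longrightarrow> G m I = tuple_coboundary (H m) I"
    by metis
  show "case p of
      0 \<Rightarrow> \<forall>I\<in>chart_tuples l1 l2 0. \<forall>m. g I m = 0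
    | Suc q \<Rightarrow> \<exists>h\<in>cech_cochains l1 l2 c a q.
        \<forall>I\<in>chart_tuples l1 l2 p. \<forall>m. g I m = cech_coboundary h I m"
  proof (cases p)
    case 0
    have "g I m = 0" if I: "I \<in> chart_tuples l1 l2 0" for I m
    proof (rule ccontr)
      assume nz: "g I m \<noteq> 0"
      then have m: "m \<in> char_lattice l1 l2 c" using g_lattice I 0 by blast
      obtain v where v: "I = [v]" "v \<in> ?W"
        using I by (auto simp: chart_tuples_def length_Suc_conv)
      have "g I m = H m []"
        using GH[OF m, of "[v]"] v I 0 by (simp add: G_def tuple_coboundary_Cons)
      then have "[] \<in> avoiding_tuples ?W (Neg m)" using H[OF m] nz by metis
      then have "Neg m = {}" by (simp add: avoiding_tuples_def)
      then show False using Neg(2)[OF m] by (simp add: whole_families_def)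
    qed
    then show ?thesis using 0 by simp
  next
    case (Suc q)
    \<comment> \<open>Setting the primitive to zero at all other characters keeps the supports finite.\<close>
    define h where "h I m = (if \<exists>J\<in>chart_tuples l1 l2 p. g J m \<noteq> 0 then H m I else 0)" for I m
    have "h I \<in> sections l1 l2 c a (\<Inter>(set I))" if I: "I \<in> chart_tuples l1 l2 q" for I
    proof -
      have "{m. h I m \<noteq> 0} \<subseteq> (\<Union>J\<in>chart_tuples l1 l2 p. {m. g J m \<noteq> 0})"
        by (auto simp: h_def split: if_splits)
      moreover have "finite (chart_tuples l1 l2 p)"
        using finite_lists_length_eq[of ?W "Suc p"] by (simp add: chart_tuples_def conj_commute)
      moreover have "finite {m. g J m \<noteq> 0}" if "J \<in> chart_tuples l1 l2 p" for J
        using that g by (auto simp: cech_cochains_def sections_def)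
      ultimately have "finite {m. h I m \<noteq> 0}" by (meson finite_UN finite_subset)
      moreover have "m \<in> char_lattice l1 l2 c \<and> (\<forall>r\<in>\<Inter>(set I). m r \<ge> - a r)" if "h I m \<noteq> 0" for m
      proof -
        have m: "m \<in> char_lattice l1 l2 c" and "H m I \<noteq> 0"
          using that g_lattice by (auto simp: h_def split: if_splits)
        then have "I \<in> avoiding_tuples ?W (Neg m)" by (rule H)
        then have disj: "Neg m \<inter> \<Inter>(set I) = {}" by (simp add: avoiding_tuples_def)
        have "I \<noteq> []" "set I \<subseteq> ?W" using I by (auto simp: chart_tuples_def)
        then have "\<Inter>(set I) \<subseteq> rays l1 l2"
          using max_cones_subset_rays by (cases I) auto
        have "m r \<ge> - a r" if "r \<in> \<Inter>(set I)" for r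
        proof -
          have "r \<in> rays l1 l2" "r \<notin> Neg m" using that disj \<open>\<Inter>(set I) \<subseteq> rays l1 l2\<close> by blast+
          then show ?thesis by (simp add: Neg_def)
        qed
        then show ?thesis using m by blast
      qed
      ultimately show ?thesis by (simp add: sections_def)
    qed
    moreover have "g I m = cech_coboundary h I m" if I: "I \<in> chart_tuples l1 l2 p" for I m
    proof (cases "\<exists>J\<in>chart_tuples l1 l2 p. g J m \<noteq> 0")
      case True
      then have m: "m \<in> char_lattice l1 l2 c" using g_lattice by blast
      have "g I m = tuple_coboundary (H m) I"
        using GH[OF m, of I] I by (simp add: G_def chart_tuples_def)
      then show ?thesis using True by (simp add: cech_coboundary_eq h_def)
    next
      case False
      then show ?thesis using I by (simp add: cech_coboundary_eq h_def)
    qed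
    ultimately show ?thesis using Suc by (auto simp: cech_cochains_def)
  qed
qed

lemma zero_in_char_lattice: "(\<lambda>_. 0) \<in> char_lattice l1 l2 c"
  by (simp add: char_lattice_def)

lemma const_in_sections:
  assumes "S \<subseteq> rays l1 l2" and "\<And>r. x \<noteq> 0 \<Longrightarrow> r \<in> S \<Longrightarrow> a r \<ge> 0"
  shows "(\<lambda>m. if m = (\<lambda>_. 0) then x else 0) \<in> sections l1 l2 c a S"
proof -
  have "{m. (if m = (\<lambda>_. 0) then x else 0) \<noteq> 0} \<subseteq> {\<lambda>_. 0}" by auto
  then have "finite {m. (if m = (\<lambda>_. 0) then x else 0) \<noteq> 0}" using finite_subset by blast
  then show ?thesis using assms(2) by (auto simp: sections_def zero_in_char_lattice)
qed

lemma Inter_charts_subset_rays: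
  assumes "I \<in> chart_tuples l1 l2 p"
  shows "\<Inter>(set I) \<subseteq> rays l1 l2"
  using assms max_cones_subset_rays by (cases I) (auto simp: chart_tuples_def)

text \<open>The component at the character \<open>0\<close> of the Cech complex is the complex of cochains that avoid the rays on
which \<open>a\<close> is negative, so it inherits exactness.\<close>

lemma tuples_exact_if_cech_cohomology_vanishes:
  assumes R: "R \<subseteq> rays l1 l2" "R \<noteq> {}"
    and a: "\<And>r. r \<in> rays l1 l2 \<Longrightarrow> r \<in> R \<longleftrightarrow> a r < 0"
    and vanish: "\<And>p. cech_cohomology_vanishes TYPE('k::field) l1 l2 c a p"
  shows "tuples_exact TYPE('k) (max_cones l1 l2) R"
proof (rule tuples_exactI)
  let ?W = "max_cones l1 l2"
  fix g :: "ray set list \<Rightarrow> 'k"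
  assume g: "\<And>I. g I \<noteq> 0 \<Longrightarrow> I \<in> avoiding_tuples ?W R"
    and cocycle: "\<And>I. set I \<subseteq> ?W \<Longrightarrow> tuple_coboundary g I = 0"
  define g0 where "g0 I m = (if m = (\<lambda>_. 0) then g I else 0)" for I and m :: "ray \<Rightarrow> int"
  have g0: "g0 \<in> cech_cochains l1 l2 c a p" for p
    unfolding cech_cochains_def
  proof (intro CollectI ballI)
    fix I assume I: "I \<in> chart_tuples l1 l2 p"
    have "a r \<ge> 0" if "g I \<noteq> 0" "r \<in> \<Inter>(set I)" for r
    proof -
      have "R \<inter> \<Inter>(set I) = {}" using g[OF that(1)] by (simp add: avoiding_tuples_def)
      then have "r \<notin> R" using that(2) by blast
      then show ?thesis using a[of r] that(2) Inter_charts_subset_rays[OF I] by auto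
    qed
    then show "g0 I \<in> sections l1 l2 c a (\<Inter>(set I))"
      unfolding g0_def by (intro const_in_sections Inter_charts_subset_rays[OF I]) auto
  qed
  have cocycle0: "cech_coboundary g0 I m = 0" if "I \<in> chart_tuples l1 l2 p" for I m p
    using cocycle[of I] that by (cases "m = (\<lambda>_. 0)") (auto simp: cech_coboundary_eq g0_def chart_tuples_def)
  have "\<exists>h \<in> cech_cochains l1 l2 c a q :: (ray set list \<Rightarrow> (ray \<Rightarrow> int) \<Rightarrow> 'k) set.
      \<forall>I\<in>chart_tuples l1 l2 (Suc q). \<forall>m. g0 I m = cech_coboundary h I m" for q
    using bspec[OF vanish[of "Suc q", unfolded cech_cohomology_vanishes_def] g0] cocycle0 by simp
  then obtain H :: "nat \<Rightarrow> ray set list \<Rightarrow> (ray \<Rightarrow> int) \<Rightarrow> 'k"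
    where H: "\<And>q. H q \<in> cech_cochains l1 l2 c a q"
      and g0H: "\<And>q I m. I \<in> chart_tuples l1 l2 (Suc q) \<Longrightarrow> g0 I m = cech_coboundary (H q) I m"
    by metis
  have g01: "g0 I m = 0" if "I \<in> chart_tuples l1 l2 0" for I m
    using bspec[OF vanish[of 0, unfolded cech_cohomology_vanishes_def] g0] cocycle0 that by simp
  define h where "h I = (if I \<noteq> [] \<and> set I \<subseteq> ?W then H (length I - 1) I (\<lambda>_. 0) else 0)" for I
  have "I \<in> avoiding_tuples ?W R" if "h I \<noteq> 0" for I
  proof -
    have I: "I \<in> chart_tuples l1 l2 (length I - 1)" "H (length I - 1) I (\<lambda>_. 0) \<noteq> 0"
      using that by (auto simp: h_def chart_tuples_def split: if_splits)
    then have "H (length I - 1) I \<in> sections l1 l2 c a (\<Inter>(set I))"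
      using H[of "length I - 1"] unfolding cech_cochains_def by blast
    then have "\<forall>r\<in>\<Inter>(set I). 0 \<ge> - a r"
      using I(2) by (auto simp: sections_def)
    then have "r \<notin> R" if "r \<in> \<Inter>(set I)" for r
      using that a[of r] R(1) by fastforce
    then have "R \<inter> \<Inter>(set I) = {}" by blast
    then show ?thesis using I(1) by (simp add: avoiding_tuples_def chart_tuples_def)
  qed
  moreover have "g I = tuple_coboundary h I" if I: "set I \<subseteq> ?W" for I
  proof -
    consider "I = []" | v where "I = [v]" | q where "length I = Suc (Suc q)"
      by (cases I rule: remdups_adj.cases) auto
    then show ?thesis
    proof cases
      case 1
      then show ?thesis using g[of "[]"] R(2) by (auto simp: avoiding_tuples_def)
    next
      case 2
      then show ?thesis using g01[of I "\<lambda>_. 0"] I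
        by (simp add: g0_def chart_tuples_def tuple_coboundary_Cons h_def)
    next
      case 3
      have "g I = cech_coboundary (H q) I (\<lambda>_. 0)"
        using g0H[of I q "\<lambda>_. 0"] 3 I by (simp add: g0_def chart_tuples_def)
      also have "\<dots> = tuple_coboundary h I"
        unfolding cech_coboundary_eq
      proof (rule tuple_coboundary_cong[OF I])
        fix J assume "set J \<subseteq> ?W" "Suc (length J) = length I"
        then show "H q J (\<lambda>_. 0) = h J" using 3 by (cases J) (auto simp: h_def)
      qed
      finally show ?thesis .
    qed
  qed
  ultimately show "\<exists>h. (\<forall>I. h I \<noteq> 0 \<longrightarrow> I \<in> avoiding_tuples ?W R) \<and>
      (\<forall>I. set I \<subseteq> ?W \<longrightarrow> g I = tuple_coboundary h I)" by blast
qed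

text \<open>An effective divisor has the constant function \<open>1\<close> as a global section.\<close>

lemma not_cech_cohomology_vanishes_0:
  assumes "l1 \<ge> 1" and "l2 \<ge> 1" and "\<And>r. r \<in> rays l1 l2 \<Longrightarrow> a r \<ge> 0"
  shows "\<not> cech_cohomology_vanishes TYPE('k::field) l1 l2 c a 0"
proof
  assume vanish: "cech_cohomology_vanishes TYPE('k) l1 l2 c a 0"
  define g :: "ray set list \<Rightarrow> (ray \<Rightarrow> int) \<Rightarrow> 'k" where "g I m = (if m = (\<lambda>_. 0) then 1 else 0)" for I m
  have "g \<in> cech_cochains l1 l2 c a 0"
    unfolding cech_cochains_def
  proof (intro CollectI ballI)
    fix I assume I: "I \<in> chart_tuples l1 l2 0"
    show "g I \<in> sections l1 l2 c a (\<Inter>(set I))"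
      unfolding g_def using Inter_charts_subset_rays[OF I] assms(3) by (intro const_in_sections) auto
  qed
  moreover have "cech_coboundary g I m = 0" if "I \<in> chart_tuples l1 l2 (Suc 0)" for I m
  proof -
    have "length I = 2" using that by (simp add: chart_tuples_def)
    then obtain v w where "I = [v, w]"
      by (cases I; cases "tl I") auto
    then show ?thesis by (simp add: cech_coboundary_eq tuple_coboundary_Cons g_def)
  qed
  ultimately have "g I m = 0" if "I \<in> chart_tuples l1 l2 0" for I m
    using bspec[OF vanish[unfolded cech_cohomology_vanishes_def], of g] that by simp
  moreover have "[rays l1 l2 - {URay 1, VRay 1}] \<in> chart_tuples l1 l2 0"
    using assms(1,2) by (force simp: chart_tuples_def max_cones_def)
  ultimately have "g [rays l1 l2 - {URay 1, VRay 1}] (\<lambda>_. 0) = 0" by blast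
  then show False by (simp add: g_def)
qed

lemma immaculate_iff_not_maculate:
  assumes "l1 \<ge> 1" and "l2 \<ge> 1"
  shows "immaculate TYPE('k::field) l1 l2 c L \<longleftrightarrow>
    L \<notin> (\<Union>R\<in>whole_families l1 l2. maculate l1 l2 c R)"
proof
  assume imm: "immaculate TYPE('k) l1 l2 c L"
  show "L \<notin> (\<Union>R\<in>whole_families l1 l2. maculate l1 l2 c R)"
  proof
    assume "L \<in> (\<Union>R\<in>whole_families l1 l2. maculate l1 l2 c R)"
    then obtain R a where R: "R \<in> whole_families l1 l2" and L: "L = class_map l1 l2 c a"
      and a: "\<forall>r\<in>rays l1 l2 - R. 0 \<le> a r" "\<forall>r\<in>R. a r \<le> - 1"
      unfolding maculate_def by blast
    have vanish: "cech_cohomology_vanishes TYPE('k) l1 l2 c a p" for p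
      using imm L by (simp add: immaculate_def)
    have "R \<subseteq> rays l1 l2" using R by (auto simp: whole_families_def rays_def)
    show False
    proof (cases "R = {}")
      case True
      then show False using not_cech_cohomology_vanishes_0[of l1 l2 a c] assms a vanish by auto
    next
      case False
      have "tuples_exact TYPE('k) (max_cones l1 l2) R"
        by (rule tuples_exact_if_cech_cohomology_vanishes[OF \<open>R \<subseteq> rays l1 l2\<close> False _ vanish])
          (use a in \<open>smt (verit) DiffI\<close>)
      then show False using not_tuples_exact_max_cones[OF assms R False] by blast
    qed
  qed
next
  assume "L \<notin> (\<Union>R\<in>whole_families l1 l2. maculate l1 l2 c R)"
  then show "immaculate TYPE('k) l1 l2 c L"
    unfolding immaculate_def
    by (intro allI impI cech_cohomology_vanishes_if_not_maculate[where L = L]) auto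
qed

section \<open>The maculate regions\<close>

text \<open>The extremal coefficient vectors: \<open>s\<close> at all \<open>u\<^sub>i\<close> and \<open>t\<close> at all \<open>v\<^sub>j\<close>, except that \<open>d\<close> is added at \<open>u\<^sub>1\<close> and
\<open>e\<close> at \<open>v\<^sub>k\<close>.\<close>

lemma mem_maculate_witness:
  fixes s t d e :: "'a::linordered_idom"
  assumes "l1 \<ge> 1" and "k \<in> {1..l2}"
    and "x = of_nat l1 * s + d + t * (\<Sum>j=1..l2. of_int (c j)) + of_int (c k) * e"
    and "y = of_nat l2 * t + e"
    and "\<And>i. i \<in> {1..l1} \<Longrightarrow>
      if URay i \<in> R then s \<le> - 1 \<and> d \<le> 0 else 0 \<le> s \<and> 0 \<le> d"
    and "\<And>j. j \<in> {1..l2} \<Longrightarrow>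
      if VRay j \<in> R then t \<le> - 1 \<and> e \<le> 0 else 0 \<le> t \<and> 0 \<le> e"
    and "R \<subseteq> rays l1 l2"
  shows "(x, y) \<in> maculate l1 l2 c R"
proof -
  define a where "a r = (case r of URay i \<Rightarrow> s + (if i = 1 then d else 0)
    | VRay j \<Rightarrow> t + (if j = k then e else 0))" for r
  have "class_map l1 l2 c a = (x, y)"
    using assms(1-4)
    by (simp add: class_map_def a_def sum.distrib distrib_left sum_distrib_left mult.commute
        if_distrib[of "\<lambda>z. _ * z"] cong: if_cong)
  moreover have "(r \<in> R \<longrightarrow> a r \<le> - 1) \<and> (r \<notin> R \<longrightarrow> 0 \<le> a r)" if "r \<in> rays l1 l2" for r
  proof (cases r)
    case (URay i)
    then have "i \<in> {1..l1}" using that by (auto simp: rays_def)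
    then show ?thesis using assms(5)[of i] URay by (auto simp: a_def split: if_splits)
  next
    case (VRay j)
    then have "j \<in> {1..l2}" using that by (auto simp: rays_def)
    then show ?thesis using assms(6)[of j] VRay by (auto simp: a_def split: if_splits)
  qed
  ultimately show ?thesis
    using assms(7) unfolding maculate_def by (intro image_eqI[of _ _ a]) auto
qed

lemma maculateE:
  assumes "(x, y) \<in> maculate l1 l2 c R"
  obtains a where
    "\<And>i. i \<in> {1..l1} \<Longrightarrow> if URay i \<in> R then a (URay i) \<le> - 1 else 0 \<le> a (URay i)"
    "\<And>j. j \<in> {1..l2} \<Longrightarrow> if VRay j \<in> R then a (VRay j) \<le> - 1 else 0 \<le> a (VRay j)"
    "x = (\<Sum>i=1..l1. a (URay i)) + (\<Sum>j=1..l2. of_int (c j) * a (VRay j))"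
    "y = (\<Sum>j=1..l2. a (VRay j))"
proof -
  obtain a where "class_map l1 l2 c a = (x, y)"
    "\<forall>r\<in>rays l1 l2 - R. 0 \<le> a r" "\<forall>r\<in>R. a r \<le> - 1"
    using assms unfolding maculate_def by (elim imageE CollectE conjE) metis
  then show thesis by (intro that[of a]) (auto simp: class_map_def rays_def)
qed

context
  fixes l1 l2 :: nat and c :: "nat \<Rightarrow> int"
  assumes l: "l1 \<ge> 1" "l2 \<ge> 1"
    and c1: "c 1 = 0"
    and c_anti: "monotone_on {1..l2} (\<le>) (\<ge>) c"
begin

text \<open>Since \<open>c\<close> decreases from \<open>c 1 = 0\<close> to \<open>c l2\<close>, a given total weight on the rays \<open>v\<^sub>j\<close> contributes most to
the first coordinate of the class when it is concentrated at one end of the family, and least when it is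
concentrated at the other end.\<close>

lemma c_bounds:
  assumes "j \<in> {1..l2}"
  shows "(of_int (c j) :: 'a::linordered_idom) \<le> 0" and "(of_int (c l2) :: 'a) \<le> of_int (c j)"
  using assms l monotone_onD[OF c_anti, of 1 j] monotone_onD[OF c_anti, of j l2] c1 by auto

lemma mem_maculate_none:
  fixes x y :: "'a::linordered_idom"
  shows "(x, y) \<in> maculate l1 l2 c {} \<longleftrightarrow> 0 \<le> y \<and> of_int (c l2) * y \<le> x"
proof
  assume "(x, y) \<in> maculate l1 l2 c {}"
  then obtain a :: "ray \<Rightarrow> 'a" where
    a: "\<And>i. i \<in> {1..l1} \<Longrightarrow> if URay i \<in> {} then a (URay i) \<le> - 1 else 0 \<le> a (URay i)"
      "\<And>j. j \<in> {1..l2} \<Longrightarrow> if VRay j \<in> {} then a (VRay j) \<le> - 1 else 0 \<le> a (VRay j)"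
    and xy: "x = (\<Sum>i=1..l1. a (URay i)) + (\<Sum>j=1..l2. of_int (c j) * a (VRay j))"
      "y = (\<Sum>j=1..l2. a (VRay j))"
    by (rule maculateE) (rule that)
  have au: "i \<in> {1..l1} \<Longrightarrow> 0 \<le> a (URay i)" for i using a(1)[of i] by (auto simp: rays_def split: if_splits)
  have av: "j \<in> {1..l2} \<Longrightarrow> 0 \<le> a (VRay j)" for j using a(2)[of j] by (auto simp: rays_def split: if_splits)
  have "(\<Sum>i=1..l1. a (URay i)) \<ge> 0" using au by (intro sum_nonneg) auto
  moreover have "(\<Sum>j=1..l2. of_int (c l2) * a (VRay j)) \<le> (\<Sum>j=1..l2. of_int (c j) * a (VRay j))"
    using av c_bounds(2) by (intro sum_mono mult_right_mono) auto
  moreover have "(\<Sum>j=1..l2. a (VRay j)) \<ge> 0" using av by (intro sum_nonneg) auto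
  ultimately show "0 \<le> y \<and> of_int (c l2) * y \<le> x"
    using xy by (auto simp: class_map_def sum_distrib_left)
next
  assume "0 \<le> y \<and> of_int (c l2) * y \<le> x"
  then show "(x, y) \<in> maculate l1 l2 c {}"
    using l by (intro mem_maculate_witness[of l1 l2 l2 x 0 "x - of_int (c l2) * y" 0 c y y]) auto
qed

lemma mem_maculate_U:
  fixes x y :: "'a::linordered_idom"
  shows "(x, y) \<in> maculate l1 l2 c (URay ` {1..l1}) \<longleftrightarrow> 0 \<le> y \<and> x \<le> - of_nat l1"
proof
  assume "(x, y) \<in> maculate l1 l2 c (URay ` {1..l1})"
  then obtain a :: "ray \<Rightarrow> 'a" where
    a: "\<And>i. i \<in> {1..l1} \<Longrightarrow> if URay i \<in> URay ` {1..l1} then a (URay i) \<le> - 1 else 0 \<le> a (URay i)"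
      "\<And>j. j \<in> {1..l2} \<Longrightarrow> if VRay j \<in> URay ` {1..l1} then a (VRay j) \<le> - 1 else 0 \<le> a (VRay j)"
    and xy: "x = (\<Sum>i=1..l1. a (URay i)) + (\<Sum>j=1..l2. of_int (c j) * a (VRay j))"
      "y = (\<Sum>j=1..l2. a (VRay j))"
    by (rule maculateE) (rule that)
  have au: "i \<in> {1..l1} \<Longrightarrow> a (URay i) \<le> - 1" for i using a(1)[of i] by (auto simp: rays_def split: if_splits)
  have av: "j \<in> {1..l2} \<Longrightarrow> 0 \<le> a (VRay j)" for j using a(2)[of j] by (auto simp: rays_def split: if_splits)
  have "(\<Sum>i=1..l1. a (URay i)) \<le> (\<Sum>i=1..l1. - 1)" using au by (intro sum_mono) auto
  moreover have "(\<Sum>j=1..l2. of_int (c j) * a (VRay j)) \<le> 0"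
    using av c_bounds(1) by (intro sum_nonpos mult_nonpos_nonneg) auto
  moreover have "(\<Sum>j=1..l2. a (VRay j)) \<ge> 0" using av by (intro sum_nonneg) auto
  ultimately show "0 \<le> y \<and> x \<le> - of_nat l1"
    using xy by (auto simp: class_map_def)
next
  assume "0 \<le> y \<and> x \<le> - of_nat l1"
  then show "(x, y) \<in> maculate l1 l2 c (URay ` {1..l1})"
    using l c1 by (intro mem_maculate_witness[of l1 1 l2 x "- 1" "x + of_nat l1" 0 c y y])
      (auto simp: rays_def)
qed

lemma mem_maculate_V:
  fixes x y :: "'a::linordered_idom"
  shows "(x, y) \<in> maculate l1 l2 c (VRay ` {1..l2}) \<longleftrightarrow>
    y \<le> - of_nat l2 \<and> 0 \<le> x + of_int (\<Sum>j=1..l2. c j)"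
proof
  assume "(x, y) \<in> maculate l1 l2 c (VRay ` {1..l2})"
  then obtain a :: "ray \<Rightarrow> 'a" where
    a: "\<And>i. i \<in> {1..l1} \<Longrightarrow> if URay i \<in> VRay ` {1..l2} then a (URay i) \<le> - 1 else 0 \<le> a (URay i)"
      "\<And>j. j \<in> {1..l2} \<Longrightarrow> if VRay j \<in> VRay ` {1..l2} then a (VRay j) \<le> - 1 else 0 \<le> a (VRay j)"
    and xy: "x = (\<Sum>i=1..l1. a (URay i)) + (\<Sum>j=1..l2. of_int (c j) * a (VRay j))"
      "y = (\<Sum>j=1..l2. a (VRay j))"
    by (rule maculateE) (rule that)
  have au: "i \<in> {1..l1} \<Longrightarrow> 0 \<le> a (URay i)" for i using a(1)[of i] by (auto simp: rays_def split: if_splits)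
  have av: "j \<in> {1..l2} \<Longrightarrow> a (VRay j) \<le> - 1" for j using a(2)[of j] by (auto simp: rays_def split: if_splits)
  have "(\<Sum>i=1..l1. a (URay i)) \<ge> 0" using au by (intro sum_nonneg) auto
  moreover have "(\<Sum>j=1..l2. of_int (c j) * (- 1)) \<le> (\<Sum>j=1..l2. of_int (c j) * a (VRay j))"
    using av c_bounds(1) by (intro sum_mono mult_left_mono_neg) auto
  moreover have "(\<Sum>j=1..l2. a (VRay j)) \<le> (\<Sum>j=1..l2. - 1)" using av by (intro sum_mono) auto
  ultimately show "y \<le> - of_nat l2 \<and> 0 \<le> x + of_int (\<Sum>j=1..l2. c j)"
    using xy by (auto simp: class_map_def sum_negf)
next
  assume "y \<le> - of_nat l2 \<and> 0 \<le> x + of_int (\<Sum>j=1..l2. c j)"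
  then show "(x, y) \<in> maculate l1 l2 c (VRay ` {1..l2})"
    using l c1
    by (intro mem_maculate_witness[of l1 1 l2 x 0 "x + of_int (\<Sum>j=1..l2. c j)" "- 1" c "y + of_nat l2" y])
      (auto simp: rays_def add_nonpos_nonpos le_minus_iff)
qed

lemma mem_maculate_rays:
  fixes x y :: "'a::linordered_idom"
  shows "(x, y) \<in> maculate l1 l2 c (rays l1 l2) \<longleftrightarrow>
    y \<le> - of_nat l2 \<and>
    x + of_int (\<Sum>j=1..l2. c j) \<le> of_int (c l2) * (y + of_nat l2) - of_nat l1"
proof
  assume "(x, y) \<in> maculate l1 l2 c (rays l1 l2)"
  then obtain a :: "ray \<Rightarrow> 'a" where
    a: "\<And>i. i \<in> {1..l1} \<Longrightarrow> if URay i \<in> rays l1 l2 then a (URay i) \<le> - 1 else 0 \<le> a (URay i)"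
      "\<And>j. j \<in> {1..l2} \<Longrightarrow> if VRay j \<in> rays l1 l2 then a (VRay j) \<le> - 1 else 0 \<le> a (VRay j)"
    and xy: "x = (\<Sum>i=1..l1. a (URay i)) + (\<Sum>j=1..l2. of_int (c j) * a (VRay j))"
      "y = (\<Sum>j=1..l2. a (VRay j))"
    by (rule maculateE) (rule that)
  have au: "i \<in> {1..l1} \<Longrightarrow> a (URay i) \<le> - 1" for i using a(1)[of i] by (auto simp: rays_def split: if_splits)
  have av: "j \<in> {1..l2} \<Longrightarrow> a (VRay j) \<le> - 1" for j using a(2)[of j] by (auto simp: rays_def split: if_splits)
  have "(\<Sum>i=1..l1. a (URay i)) \<le> (\<Sum>i=1..l1. - 1)"
    using au by (intro sum_mono) auto
  moreover have "(\<Sum>j=1..l2. of_int (c j) * (a (VRay j) + 1)) \<le> (\<Sum>j=1..l2. of_int (c l2) * (a (VRay j) + 1))"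
    using av c_bounds(2) by (intro sum_mono mult_right_mono_neg) force+
  then have "(\<Sum>j=1..l2. of_int (c j) * a (VRay j)) + of_int (\<Sum>j=1..l2. c j) \<le>
      of_int (c l2) * ((\<Sum>j=1..l2. a (VRay j)) + of_nat l2)"
    by (simp add: distrib_left sum.distrib sum_distrib_left mult.commute)
  moreover have "(\<Sum>j=1..l2. a (VRay j)) \<le> (\<Sum>j=1..l2. - 1)" using av by (intro sum_mono) auto
  ultimately show "y \<le> - of_nat l2 \<and>
    x + of_int (\<Sum>j=1..l2. c j) \<le> of_int (c l2) * (y + of_nat l2) - of_nat l1"
    using xy by (auto simp: class_map_def)
next
  assume "y \<le> - of_nat l2 \<and>
    x + of_int (\<Sum>j=1..l2. c j) \<le> of_int (c l2) * (y + of_nat l2) - of_nat l1"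
  then show "(x, y) \<in> maculate l1 l2 c (rays l1 l2)"
    using l
    by (intro mem_maculate_witness[of l1 l2 l2 x "- 1"
          "x + of_int (\<Sum>j=1..l2. c j) + of_nat l1 - of_int (c l2) * (y + of_nat l2)"
          "- 1" c "y + of_nat l2" y])
      (auto simp: rays_def algebra_simps le_minus_iff)
qed

end

section \<open>Acyclicity of star-shaped sets\<close>

lemma singular_coboundary_simplex_map:
  "singular_coboundary p (\<lambda>s. f (simplex_map p h s)) s = singular_coboundary p f (simplex_map (Suc p) h s)"
proof -
  have "simplex_map p h (singular_face (Suc p) i s) = singular_face (Suc p) i (simplex_map (Suc p) h s)"
    if "i \<le> Suc p" for i
    using that by (simp add: singular_face_simplex_map)
      (auto simp: simplex_map_def singular_face_def fun_eq_iff restrict_def)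
  then show ?thesis
    unfolding singular_coboundary_def by (intro sum.cong) auto
qed

lemma singular_cohomology_vanishes_retract:
  assumes r: "continuous_map Y X r" and s: "continuous_map X Y s"
    and rs: "\<And>x. x \<in> topspace X \<Longrightarrow> r (s x) = x"
    and "p \<ge> 1" and vanish: "singular_cohomology_vanishes TYPE('k::field) p Y"
  shows "singular_cohomology_vanishes TYPE('k) p X"
proof -
  obtain q where q: "p = Suc q" using \<open>p \<ge> 1\<close> by (cases p) auto
  have "\<exists>g. \<forall>t. singular_simplex p X t \<longrightarrow> f t = singular_coboundary q g t"
    if f: "\<forall>t. singular_simplex (Suc p) X t \<longrightarrow> singular_coboundary p f t = 0"
    for f :: "((nat \<Rightarrow> real) \<Rightarrow> 'b) \<Rightarrow> 'k"
  proof -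
    have "singular_coboundary p (\<lambda>t. f (simplex_map p r t)) t = 0"
      if "singular_simplex (Suc p) Y t" for t
      using singular_coboundary_simplex_map[of p f r t] f
        singular_simplex_simplex_map[OF that r] by simp
    then have "\<exists>g. \<forall>t. singular_simplex p Y t \<longrightarrow> f (simplex_map p r t) = singular_coboundary q g t"
      using vanish[unfolded singular_cohomology_vanishes_def, rule_format, of "\<lambda>t. f (simplex_map p r t)"]
      by (simp add: q)
    then obtain g :: "((nat \<Rightarrow> real) \<Rightarrow> 'a) \<Rightarrow> 'k"
      where g: "\<And>t. singular_simplex p Y t \<Longrightarrow> f (simplex_map p r t) = singular_coboundary q g t"
      by blast
    have "f t = singular_coboundary q (\<lambda>t. g (simplex_map q s t)) t" if t: "singular_simplex p X t" for t
    proof -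
      have "simplex_map p r (simplex_map p s t) = t"
      proof
        fix x
        show "simplex_map p r (simplex_map p s t) x = t x"
        proof (cases "x \<in> standard_simplex p")
          case True
          then have "t x \<in> topspace X"
            using t by (auto simp: singular_simplex_def continuous_map_def)
          then show ?thesis using True by (simp add: simplex_map_def rs)
        next
          case False
          then show ?thesis using t by (simp add: simplex_map_def singular_simplex_def extensional_def)
        qed
      qed
      then show ?thesis
        using g[OF singular_simplex_simplex_map[OF t s]] t singular_coboundary_simplex_map[of q g s t]
        by (simp add: q)
    qed
    then show ?thesis by blast
  qed
  then show ?thesis unfolding singular_cohomology_vanishes_def q nat.case by blast
qed

lemma acyclic_space_homeomorphic:
  assumes "X homeomorphic_space Y" and "acyclic_space TYPE('k::field) X"
  shows "acyclic_space TYPE('k) Y"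
proof -
  obtain f g where fg: "homeomorphic_maps X Y f g" using assms(1) by (auto simp: homeomorphic_space_def)
  then have "continuous_map X Y f" "continuous_map Y X g" "\<And>y. y \<in> topspace Y \<Longrightarrow> f (g y) = y"
    by (auto simp: homeomorphic_maps_def)
  then have "singular_cohomology_vanishes TYPE('k) p Y" if "p \<ge> 1" for p
    using singular_cohomology_vanishes_retract[of X Y f g p] assms(2) that by (auto simp: acyclic_space_def)
  moreover have "path_connected_space Y"
    using homeomorphic_path_connected_space[OF assms(1)] assms(2) by (simp add: acyclic_space_def)
  moreover have "topspace Y \<noteq> {}"
    using homeomorphic_empty_space[OF assms(1)] assms(2) by (auto simp: acyclic_space_def)
  ultimately show ?thesis by (simp add: acyclic_space_def)
qed

text \<open>Continuity of a cone at its apex: there \<open>h\<close> measures the distance from the apex, and \<open>g\<close>, which has no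
limit at the apex, is bounded because the base is compact.\<close>

lemma continuous_on_mult_bounded:
  fixes h g :: "'a::topological_space \<Rightarrow> real"
  assumes h: "continuous_on S h" and g: "continuous_on (S \<inter> {x. h x \<noteq> 0}) g"
    and bound: "\<And>x. x \<in> S \<Longrightarrow> h x \<noteq> 0 \<Longrightarrow> \<bar>g x\<bar> \<le> B"
  shows "continuous_on S (\<lambda>x. h x * g x)"
  unfolding continuous_on_def
proof
  fix x assume x: "x \<in> S"
  have hx: "(h \<longlongrightarrow> h x) (at x within S)" using h x by (simp add: continuous_on_def)
  show "((\<lambda>x. h x * g x) \<longlongrightarrow> h x * g x) (at x within S)"
  proof (cases "h x = 0")
    case True
    have "((\<lambda>y. \<bar>h y\<bar> * B) \<longlongrightarrow> 0) (at x within S)"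
      using tendsto_mult[OF tendsto_rabs[OF hx] tendsto_const[of B]] True by simp
    moreover have "eventually (\<lambda>y. norm (h y * g y) \<le> \<bar>h y\<bar> * B) (at x within S)"
      unfolding eventually_at_filter
    proof (intro always_eventually allI impI)
      fix y assume "y \<in> S"
      then show "norm (h y * g y) \<le> \<bar>h y\<bar> * B"
        using bound[of y] by (cases "h y = 0") (auto simp: abs_mult intro: mult_left_mono)
    qed
    ultimately have "((\<lambda>y. h y * g y) \<longlongrightarrow> 0) (at x within S)"
      by (rule Lim_null_comparison[rotated])
    then show ?thesis using True by simp
  next
    case False
    have "eventually (\<lambda>y. h y \<noteq> 0) (at x within S)"
      using tendsto_imp_eventually_ne[OF hx False] .
    then have "at x within S \<le> principal {y. h y \<noteq> 0}" by (simp add: le_principal)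
    moreover have "at x within (S \<inter> {y. h y \<noteq> 0}) = inf (at x within S) (principal {y. h y \<noteq> 0})"
    proof -
      have "S \<inter> {y. h y \<noteq> 0} - {x} = (S - {x}) \<inter> {y. h y \<noteq> 0}" by blast
      then show ?thesis by (simp only: at_within_def inf_assoc inf_principal)
    qed
    ultimately have eq: "at x within (S \<inter> {y. h y \<noteq> 0}) = at x within S"
      by (simp add: inf_absorb1)
    have "(g \<longlongrightarrow> g x) (at x within (S \<inter> {y. h y \<noteq> 0}))"
      using g x False by (simp add: continuous_on_def)
    then have "(g \<longlongrightarrow> g x) (at x within S)" unfolding eq .
    then show ?thesis using hx by (intro tendsto_mult)
  qed
qed

text \<open>The cone with apex \<open>a\<close> over a singular simplex \<open>s\<close>; vertex \<open>0\<close> of the larger simplex goes to \<open>a\<close> and the opposite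
face is \<open>s\<close>. The division is meaningless at vertex \<open>0\<close> itself, hence the case distinction.\<close>

definition simplex_cone_map :: "nat \<Rightarrow> ('i \<Rightarrow> real) \<Rightarrow> ((nat \<Rightarrow> real) \<Rightarrow> 'i \<Rightarrow> real) \<Rightarrow> (nat \<Rightarrow> real) \<Rightarrow> 'i \<Rightarrow> real" where
  "simplex_cone_map p a s = restrict
     (\<lambda>x. if x 0 = 1 then a else (\<lambda>i. x 0 * a i + (1 - x 0) * s (\<lambda>j. x (Suc j) / (1 - x 0)) i))
     (standard_simplex (Suc p))"

lemma opposite_face_coordinates:
  assumes x: "x \<in> standard_simplex (Suc p)" and "x 0 \<noteq> 1"
  shows "(\<lambda>j. x (Suc j) / (1 - x 0)) \<in> standard_simplex p"
proof -
  have nn: "\<And>i. 0 \<le> x i" and le: "\<And>i. x i \<le> 1" and zero: "\<And>i. i > Suc p \<Longrightarrow> x i = 0"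
    and sum: "(\<Sum>i\<le>Suc p. x i) = 1"
    using x by (auto simp: standard_simplex_def)
  have pos: "1 - x 0 > 0" using le[of 0] \<open>x 0 \<noteq> 1\<close> by simp
  have s: "(\<Sum>j\<le>p. x (Suc j)) = 1 - x 0" using sum unfolding sum.atMost_Suc_shift by simp
  have "x (Suc j) \<le> 1 - x 0" for j
  proof (cases "j \<le> p")
    case True
    then have "x (Suc j) \<le> (\<Sum>j\<le>p. x (Suc j))" by (intro member_le_sum) (auto simp: nn)
    then show ?thesis using s by simp
  next
    case False
    then show ?thesis using zero[of "Suc j"] pos by simp
  qed
  then show ?thesis
    using pos nn zero s by (auto simp: standard_simplex_def simp flip: sum_divide_distrib)
qed

lemma singular_simplex_cone_map:
  fixes a :: "'i \<Rightarrow> real"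
  assumes star: "\<And>w t. w \<in> S \<Longrightarrow> 0 \<le> t \<Longrightarrow> t \<le> 1 \<Longrightarrow> (\<lambda>i. t * a i + (1 - t) * w i) \<in> S"
    and "a \<in> S" and s: "singular_simplex p (subtopology (powertop_real UNIV) S) s"
  shows "singular_simplex (Suc p) (subtopology (powertop_real UNIV) S) (simplex_cone_map p a s)"
proof -
  let ?D = "standard_simplex (Suc p)"
  define y where "y x = (\<lambda>j. x (Suc j) / (1 - x 0))" for x :: "nat \<Rightarrow> real"
  have s_cont: "continuous_on (standard_simplex p) s" and s_im: "s ` standard_simplex p \<subseteq> S"
    using s by (auto simp: singular_simplex_def euclidean_product_topology continuous_map_in_subtopology)
  have y: "y x \<in> standard_simplex p" if "x \<in> ?D" "x 0 \<noteq> 1" for x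
    unfolding y_def using that by (rule opposite_face_coordinates)
  \<comment> \<open>The same map in a form without case distinction, since the second summand vanishes at the apex.\<close>
  define F where "F x = (\<lambda>i. a i + (1 - x 0) * (s (y x) i - a i))" for x
  have F: "simplex_cone_map p a s x = F x" if "x \<in> ?D" for x
    using that by (auto simp: simplex_cone_map_def F_def y_def algebra_simps)
  have "continuous_on ?D (\<lambda>x. F x i)" for i
  proof -
    have coord: "continuous_on T (\<lambda>x::nat \<Rightarrow> real. x j)" for T j
      by (rule continuous_on_subset[OF continuous_on_product_coordinates]) simp
    have cpt: "compact ((\<lambda>x. s x i - a i) ` standard_simplex p)"
    proof (rule compact_continuous_image)
      show "continuous_on (standard_simplex p) (\<lambda>x. s x i - a i)"
        by (intro continuous_intros continuous_on_product_then_coordinatewise[OF s_cont])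
      show "compact (standard_simplex p)"
        using compactin_standard_simplex[of p] by (simp add: euclidean_product_topology)
    qed
    obtain B where "\<forall>v\<in>(\<lambda>x. s x i - a i) ` standard_simplex p. norm v \<le> B"
      using compact_imp_bounded[OF cpt, unfolded bounded_iff] by (elim exE)
    then have B: "\<bar>s x i - a i\<bar> \<le> B" if "x \<in> standard_simplex p" for x
      using that by simp
    have ycont: "continuous_on (?D \<inter> {x. 1 - x 0 \<noteq> 0}) y"
      unfolding y_def by (intro continuous_on_coordinatewise_then_product continuous_intros coord) auto
    have "continuous_on (?D \<inter> {x. 1 - x 0 \<noteq> 0}) (\<lambda>x. s (y x))"
      by (rule continuous_on_compose2[OF s_cont ycont]) (use y in auto)
    then have "continuous_on (?D \<inter> {x. 1 - x 0 \<noteq> 0}) (\<lambda>x. s (y x) i)"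
      by (rule continuous_on_product_then_coordinatewise)
    then have "continuous_on (?D \<inter> {x. 1 - x 0 \<noteq> 0}) (\<lambda>x. s (y x) i - a i)"
      by (intro continuous_intros)
    then have "continuous_on ?D (\<lambda>x. (1 - x 0) * (s (y x) i - a i))"
      by (intro continuous_on_mult_bounded[where B = B and h = "\<lambda>x. 1 - x 0" and g = "\<lambda>x. s (y x) i - a i"]
          continuous_on_diff[OF continuous_on_const coord]) (use y B in auto)
    then show ?thesis unfolding F_def by (rule continuous_on_add[OF continuous_on_const])
  qed
  then have "continuous_on ?D F" by (rule continuous_on_coordinatewise_then_product)
  then have "continuous_on ?D (simplex_cone_map p a s)"
    using F by (simp cong: continuous_on_cong)
  moreover have "simplex_cone_map p a s x \<in> S" if x: "x \<in> ?D" for x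
  proof (cases "x 0 = 1")
    case True
    then show ?thesis using \<open>a \<in> S\<close> x by (simp add: simplex_cone_map_def)
  next
    case False
    have "s (y x) \<in> S" using y[OF x False] s_im by blast
    then have "(\<lambda>i. x 0 * a i + (1 - x 0) * s (y x) i) \<in> S"
      using x by (intro star) (auto simp: standard_simplex_def)
    then show ?thesis using x False by (simp add: simplex_cone_map_def y_def)
  qed
  ultimately show ?thesis
    by (auto simp: singular_simplex_def euclidean_product_topology continuous_map_in_subtopology
        simplex_cone_map_def)
qed

lemma singular_face_0_cone_map:
  assumes "s \<in> extensional (standard_simplex p)"
  shows "singular_face (Suc p) 0 (simplex_cone_map p a s) = s"
proof
  fix x
  show "singular_face (Suc p) 0 (simplex_cone_map p a s) x = s x"
  proof (cases "x \<in> standard_simplex p")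
    case True
    then have "simplical_face 0 x \<in> standard_simplex (Suc p)"
      using simplical_face_in_standard_simplex[of "Suc p" 0 x] by simp
    then show ?thesis using True
      by (simp add: singular_face_def simplex_cone_map_def simplical_face_def)
  next
    case False
    then show ?thesis using assms by (simp add: singular_face_def extensional_def)
  qed
qed

text \<open>Together with the previous lemma this says that coning is a contracting homotopy of the singular
chain complex in positive degrees.\<close>

lemma singular_face_Suc_cone_map:
  assumes "i \<le> Suc p"
  shows "singular_face (Suc (Suc p)) (Suc i) (simplex_cone_map (Suc p) a s) =
    simplex_cone_map p a (singular_face (Suc p) i s)"
proof
  fix x
  show "singular_face (Suc (Suc p)) (Suc i) (simplex_cone_map (Suc p) a s) x =
    simplex_cone_map p a (singular_face (Suc p) i s) x"
  proof (cases "x \<in> standard_simplex (Suc p)")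
    case x: True
    have face: "simplical_face (Suc i) x \<in> standard_simplex (Suc (Suc p))"
      using simplical_face_in_standard_simplex[of "Suc (Suc p)" "Suc i" x] assms x by simp
    have x0: "simplical_face (Suc i) x 0 = x 0" by (simp add: simplical_face_def)
    have y: "(\<lambda>j. simplical_face (Suc i) x (Suc j) / (1 - x 0)) =
        simplical_face i (\<lambda>j. x (Suc j) / (1 - x 0))"
    proof
      fix j
      show "simplical_face (Suc i) x (Suc j) / (1 - x 0) = simplical_face i (\<lambda>j. x (Suc j) / (1 - x 0)) j"
        by (cases j) (auto simp: simplical_face_def)
    qed
    show ?thesis
    proof (cases "x 0 = 1")
      case True
      then show ?thesis using x face x0 by (simp add: singular_face_def simplex_cone_map_def)
    next
      case False
      then show ?thesis
        using x face x0 y opposite_face_coordinates[OF x False]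
        by (simp add: singular_face_def simplex_cone_map_def)
    qed
  next
    case False
    then show ?thesis by (simp add: singular_face_def simplex_cone_map_def)
  qed
qed

lemma acyclic_space_star_shaped:
  fixes a :: "'i \<Rightarrow> real"
  assumes star: "\<And>w t. w \<in> S \<Longrightarrow> 0 \<le> t \<Longrightarrow> t \<le> 1 \<Longrightarrow> (\<lambda>i. t * a i + (1 - t) * w i) \<in> S"
    and "a \<in> S"
  shows "acyclic_space TYPE('k::field) (subtopology (powertop_real UNIV) S)"
proof -
  let ?X = "subtopology (powertop_real UNIV) S"
  have "singular_cohomology_vanishes TYPE('k) p ?X" if "p \<ge> 1" for p
  proof -
    obtain q where q: "p = Suc q" using \<open>p \<ge> 1\<close> by (cases p) auto
    have "\<exists>g. \<forall>s. singular_simplex p ?X s \<longrightarrow> f s = singular_coboundary q g s"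
      if f: "\<forall>s. singular_simplex (Suc p) ?X s \<longrightarrow> singular_coboundary p f s = 0"
      for f :: "((nat \<Rightarrow> real) \<Rightarrow> 'i \<Rightarrow> real) \<Rightarrow> 'k"
    proof -
      have "f s = singular_coboundary q (\<lambda>t. f (simplex_cone_map q a t)) s"
        if s: "singular_simplex p ?X s" for s
      proof -
        have "0 = singular_coboundary p f (simplex_cone_map p a s)"
          using f singular_simplex_cone_map[OF star \<open>a \<in> S\<close> s] by simp
        also have "\<dots> = f s - singular_coboundary q (\<lambda>t. f (simplex_cone_map q a t)) s"
          unfolding q singular_coboundary_def sum.atMost_Suc_shift[of _ "Suc q"]
          using s singular_face_0_cone_map[of s "Suc q" a]
          by (simp add: q singular_simplex_def singular_face_Suc_cone_map sum_negf del: sum.atMost_Suc)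
        finally show ?thesis by simp
      qed
      then show ?thesis by blast
    qed
    then show ?thesis unfolding singular_cohomology_vanishes_def q nat.case by blast
  qed
  moreover have "contractible_space ?X"
  proof -
    let ?h = "\<lambda>(t, w) i. t * a i + (1 - t) * w i"
    have "continuous_map (prod_topology (top_of_set {0..1}) ?X) (powertop_real UNIV) ?h"
      unfolding continuous_map_componentwise_UNIV case_prod_unfold prod_topology_subtopology
      by (intro allI continuous_intros continuous_map_from_subtopology continuous_map_prod_snd) auto
    then have "continuous_map (prod_topology (top_of_set {0..1}) ?X) ?X ?h"
      using star by (auto simp: continuous_map_in_subtopology)
    then have "homotopic_with (\<lambda>x. True) ?X ?X id (\<lambda>x. a)"
      by (simp add: homotopic_with) (rule exI[of _ ?h], simp)
    then show ?thesis unfolding contractible_space_def by blast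
  qed
  then have "path_connected_space ?X" by (rule contractible_imp_path_connected_space)
  ultimately show ?thesis using \<open>a \<in> S\<close> by (auto simp: acyclic_space_def)
qed

section \<open>Additive functionals on chains\<close>

definition chain_eval :: "('b \<Rightarrow> 'k::field) \<Rightarrow> ('b \<Rightarrow>\<^sub>0 int) \<Rightarrow> 'k" where
  "chain_eval g c = (\<Sum>s\<in>Poly_Mapping.keys c. of_int (Poly_Mapping.lookup c s) * g s)"

lemma chain_eval_superset:
  assumes "finite S" and "Poly_Mapping.keys c \<subseteq> S"
  shows "chain_eval g c = (\<Sum>s\<in>S. of_int (Poly_Mapping.lookup c s) * g s)"
  unfolding chain_eval_def using assms
  by (intro sum.mono_neutral_left) (auto simp: in_keys_iff)

lemma chain_eval_diff: "chain_eval g (x - y) = chain_eval g x - chain_eval g y"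
proof -
  let ?S = "Poly_Mapping.keys x \<union> Poly_Mapping.keys y"
  have "chain_eval g (x - y) = (\<Sum>s\<in>?S. of_int (Poly_Mapping.lookup (x - y) s) * g s)"
    by (rule chain_eval_superset) (auto simp: keys_diff)
  also have "\<dots> = chain_eval g x - chain_eval g y"
    by (simp add: chain_eval_superset[of ?S] lookup_minus left_diff_distrib sum_subtractf)
  finally show ?thesis .
qed

lemma chain_eval_frag_of [simp]: "chain_eval g (frag_of s) = g s"
  by (simp add: chain_eval_def)

lemma additive_frag_cmul:
  fixes \<phi> :: "('b \<Rightarrow>\<^sub>0 int) \<Rightarrow> 'k::field"
  assumes diff: "\<And>x y. \<phi> (x - y) = \<phi> x - \<phi> y"
  shows "\<phi> (frag_cmul n x) = of_int n * \<phi> x"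
proof -
  have zero: "\<phi> 0 = 0" using diff[of 0 0] by simp
  show ?thesis
  proof (induction n rule: int_induct[where k = 0])
    case base
    then show ?case by (simp add: zero)
  next
    case (step1 i)
    have "frag_cmul (i + 1) x = frag_cmul i x - (0 - x)"
      by (simp add: frag_cmul_distrib)
    then show ?case using step1 by (simp only: diff zero) (simp add: algebra_simps)
  next
    case (step2 i)
    have "frag_cmul (i - 1) x = frag_cmul i x - x"
      by (simp add: frag_cmul_diff_distrib)
    then show ?case using step2 by (simp only: diff) (simp add: algebra_simps)
  qed
qed

lemma additive_chain_boundary:
  fixes \<phi> :: "'a chain \<Rightarrow> 'k::field"
  assumes diff: "\<And>x y. \<phi> (x - y) = \<phi> x - \<phi> y"
  shows "\<phi> (chain_boundary (Suc p) (frag_of s)) = singular_coboundary p (\<lambda>s. \<phi> (frag_of s)) s"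
proof -
  have zero: "\<phi> 0 = 0" using diff[of 0 0] by simp
  have add: "\<phi> (x + y) = \<phi> x + \<phi> y" for x y
    using diff[of "x + y" y] by simp
  have "\<phi> (sum f I) = (\<Sum>i\<in>I. \<phi> (f i))" for f and I :: "nat set"
    by (induction I rule: infinite_finite_induct) (simp_all add: zero add)
  then show ?thesis
    by (simp add: chain_boundary_of singular_coboundary_def additive_frag_cmul[OF diff] del: sum.atMost_Suc)
qed

text \<open>Separation of \<open>z\<close> from the subgroup \<open>B\<close> by a \<open>'k\<close>-valued functional. In characteristic \<open>p > 0\<close> this
is linear algebra over the prime field, applied to the quotient by \<open>B\<close>, where multiplication by \<open>p\<close> is zero; in characteristic \<open>0\<close> it is the same after
tensoring with the rationals. A single proof covers both: choose a subgroup \<open>M\<close> maximal among those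
with the property assumed for \<open>B\<close>. Then \<open>M\<close> is the kernel of the functional sought, because modulo \<open>M\<close>
every \<open>x\<close> is a fraction \<open>n / m\<close> of \<open>z\<close>.\<close>

lemma additive_functional_exists:
  fixes z :: "'b \<Rightarrow>\<^sub>0 int"
  assumes zero: "0 \<in> B" and diff: "\<And>x y. x \<in> B \<Longrightarrow> y \<in> B \<Longrightarrow> x - y \<in> B"
    and char: "\<And>x. frag_cmul (int CHAR('k::field)) x \<in> B"
    and z: "\<And>n. frag_cmul n z \<in> B \<Longrightarrow> of_int n = (0 :: 'k::field)"
  obtains \<phi> :: "('b \<Rightarrow>\<^sub>0 int) \<Rightarrow> 'k::field"
  where "\<And>x y. \<phi> (x - y) = \<phi> x - \<phi> y" and "\<phi> z = 1" and "\<And>b. b \<in> B \<Longrightarrow> \<phi> b = 0"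
proof -
  define \<A> where "\<A> = {H. B \<subseteq> H \<and> (\<forall>x\<in>H. \<forall>y\<in>H. x - y \<in> H) \<and>
    (\<forall>n. frag_cmul n z \<in> H \<longrightarrow> of_int n = (0 :: 'k))}"
  have "B \<in> \<A>" using diff z by (auto simp: \<A>_def)
  have "\<exists>M\<in>\<A>. \<forall>H\<in>\<A>. M \<subseteq> H \<longrightarrow> H = M"
  proof (rule subset_Zorn_nonempty)
    show "\<A> \<noteq> {}" using \<open>B \<in> \<A>\<close> by blast
    fix C assume C: "C \<noteq> {}" "subset.chain \<A> C"
    then have lin: "H \<subseteq> H' \<or> H' \<subseteq> H" if "H \<in> C" "H' \<in> C" for H H'
      using that by (auto simp: subset.chain_def)
    have sub: "H \<in> \<A>" if "H \<in> C" for H using C(2) that by (auto simp: subset.chain_def)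
    have "x - y \<in> \<Union>C" if xy: "x \<in> \<Union>C" "y \<in> \<Union>C" for x y
    proof -
      obtain H H' where H: "H \<in> C" "H' \<in> C" "x \<in> H" "y \<in> H'" using xy by blast
      then have "x \<in> H \<and> y \<in> H \<or> x \<in> H' \<and> y \<in> H'" using lin[OF H(1,2)] by blast
      then show ?thesis using sub H(1,2) unfolding \<A>_def by blast
    qed
    moreover have "B \<subseteq> \<Union>C" using C(1) sub unfolding \<A>_def by blast
    moreover have "of_int n = (0 :: 'k)" if "frag_cmul n z \<in> \<Union>C" for n
      using that sub unfolding \<A>_def by blast
    ultimately show "\<Union>C \<in> \<A>" unfolding \<A>_def by blast
  qed
  then obtain M where M: "M \<in> \<A>" and max: "\<And>H. H \<in> \<A> \<Longrightarrow> M \<subseteq> H \<Longrightarrow> H = M" by blast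
  have BM: "B \<subseteq> M" and Mdiff: "\<And>x y. x \<in> M \<Longrightarrow> y \<in> M \<Longrightarrow> x - y \<in> M"
    and Mz: "\<And>n. frag_cmul n z \<in> M \<Longrightarrow> of_int n = (0 :: 'k)"
    using M by (auto simp: \<A>_def)
  have M0: "0 \<in> M" using BM zero by blast
  have Mcmul: "frag_cmul n x \<in> M" if "x \<in> M" for n x
    using frag_closure_minus_cmul[of "\<lambda>x. x \<in> M", OF M0 Mdiff that] .
  define rel where "rel x n m \<longleftrightarrow> of_int m \<noteq> (0 :: 'k) \<and> frag_cmul m x - frag_cmul n z \<in> M" for x n m
  have rel_exists: "\<exists>n m. rel x n m" for x
  proof (rule ccontr)
    assume none: "\<nexists>n m. rel x n m"
    define M' where "M' = {h + frag_cmul m x | h m. h \<in> M}"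
    have "M \<subseteq> M'"
    proof
      fix h assume "h \<in> M"
      then show "h \<in> M'" unfolding M'_def by (intro CollectI exI[of _ h] exI[of _ 0]) simp
    qed
    moreover have "M' \<in> \<A>"
    proof -
      have "u - v \<in> M'" if uv: "u \<in> M'" "v \<in> M'" for u v
      proof -
        obtain h m h' m' where "h \<in> M" "h' \<in> M" and u: "u = h + frag_cmul m x" and v: "v = h' + frag_cmul m' x"
          using uv unfolding M'_def by blast
        then have "h - h' \<in> M" using Mdiff by blast
        moreover have "u - v = (h - h') + frag_cmul (m - m') x"
          by (simp add: u v frag_cmul_diff_distrib)
        ultimately show ?thesis unfolding M'_def by blast
      qed
      moreover have "of_int n = (0 :: 'k)" if "frag_cmul n z \<in> M'" for n
      proof -
        obtain h m where h: "h \<in> M" "frag_cmul n z = h + frag_cmul m x"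
          using \<open>frag_cmul n z \<in> M'\<close> unfolding M'_def by blast
        have "frag_cmul m x - frag_cmul n z = 0 - h" by (simp add: h(2))
        then have "frag_cmul m x - frag_cmul n z \<in> M" using Mdiff[OF M0 h(1)] by simp
        then have "of_int m = (0 :: 'k)" using none by (auto simp: rel_def)
        \<comment> \<open>In characteristic \<open>0\<close> this says \<open>m = 0\<close>.\<close>
        then obtain m' where "m = int CHAR('k) * m'" by (auto simp: of_int_eq_0_iff_char_dvd)
        then have eq: "frag_cmul m x = frag_cmul (int CHAR('k)) (frag_cmul m' x)" by simp
        have "frag_cmul m x \<in> M" unfolding eq using char BM by blast
        then have "h - (0 - frag_cmul m x) \<in> M" using Mdiff M0 h(1) by blast
        also have "h - (0 - frag_cmul m x) = frag_cmul n z" by (simp only: h(2)) simp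
        finally show ?thesis by (rule Mz)
      qed
      ultimately show ?thesis using BM \<open>M \<subseteq> M'\<close> by (auto simp: \<A>_def)
    qed
    ultimately have "M' = M" using max by blast
    moreover have "x \<in> M'" unfolding M'_def by (intro CollectI exI[of _ 0] exI[of _ 1]) (simp add: M0)
    ultimately have "rel x 0 1" by (simp add: rel_def)
    then show False using none by blast
  qed
  have rel_unique: "of_int n / of_int m = (of_int n' / of_int m' :: 'k)"
    if "rel x n m" "rel x n' m'" for x n m n' m'
  proof -
    have "frag_cmul m (frag_cmul m' x - frag_cmul n' z) - frag_cmul m' (frag_cmul m x - frag_cmul n z) \<in> M"
      by (rule Mdiff[OF Mcmul Mcmul]) (use that in \<open>auto simp: rel_def\<close>)
    also have "frag_cmul m (frag_cmul m' x - frag_cmul n' z) - frag_cmul m' (frag_cmul m x - frag_cmul n z)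
        = frag_cmul (m' * n - m * n') z"
      by (intro poly_mapping_eqI) (simp add: lookup_minus algebra_simps)
    finally have "of_int (m' * n - m * n') = (0 :: 'k)" by (rule Mz)
    then show ?thesis using that by (simp add: rel_def field_simps)
  qed
  define \<phi> :: "('b \<Rightarrow>\<^sub>0 int) \<Rightarrow> 'k"
    where "\<phi> x = (SOME q. \<exists>n m. rel x n m \<and> q = of_int n / of_int m)" for x
  have \<phi>: "\<phi> x = of_int n / of_int m" if "rel x n m" for x n m
  proof -
    have "\<exists>n m. rel x n m \<and> \<phi> x = of_int n / of_int m"
      unfolding \<phi>_def by (rule someI_ex) (use that in blast)
    then show ?thesis using rel_unique that by metis
  qed
  show thesis
  proof
    fix x y
    obtain n m n' m' where x: "rel x n m" and y: "rel y n' m'" using rel_exists by metis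
    have "frag_cmul m' (frag_cmul m x - frag_cmul n z) - frag_cmul m (frag_cmul m' y - frag_cmul n' z) \<in> M"
      by (rule Mdiff[OF Mcmul Mcmul]) (use x y in \<open>auto simp: rel_def\<close>)
    also have "frag_cmul m' (frag_cmul m x - frag_cmul n z) - frag_cmul m (frag_cmul m' y - frag_cmul n' z)
        = frag_cmul (m * m') (x - y) - frag_cmul (m' * n - m * n') z"
      by (intro poly_mapping_eqI) (simp add: lookup_minus algebra_simps)
    finally have "rel (x - y) (m' * n - m * n') (m * m')" using x y by (simp add: rel_def)
    then have "\<phi> (x - y) = of_int (m' * n - m * n') / of_int (m * m')" by (rule \<phi>)
    moreover have "of_int m \<noteq> (0 :: 'k)" "of_int m' \<noteq> (0 :: 'k)" using x y by (simp_all add: rel_def)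
    ultimately show "\<phi> (x - y) = \<phi> x - \<phi> y"
      unfolding \<phi>[OF x] \<phi>[OF y] by (simp add: field_simps)
  next
    have "rel z 1 1" by (simp add: rel_def M0)
    then show "\<phi> z = 1" using \<phi> by fastforce
  next
    fix b assume "b \<in> B"
    then have "rel b 0 1" using BM by (auto simp: rel_def)
    then show "\<phi> b = 0" using \<phi> by fastforce
  qed
qed

section \<open>Spaces with infinite cyclic homology\<close>

text \<open>The isomorphism as a function on cycles, so that later computations need no classes.\<close>

lemma homology_coordinate:
  assumes "homology_group (int p) X \<cong> integer_group"
  obtains F where
    "\<And>c d. singular_relcycle p X {} c \<Longrightarrow> singular_relcycle p X {} d \<Longrightarrow> F (c + d) = F c + (F d :: int)"
    "\<And>c. singular_relcycle p X {} c \<Longrightarrow> F c = 0 \<longleftrightarrow> singular_relboundary p X {} c"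
    "\<exists>z. singular_relcycle p X {} z \<and> F z = 1"
proof -
  let ?H = "homology_group (int p) X" and ?Z = "relcycle_group p X {}"
  let ?cl = "\<lambda>c. homologous_rel_set p X {} c"
  obtain f where f: "f \<in> iso ?H integer_group" using assms by (auto simp: is_iso_def)
  then have fhom: "f \<in> hom ?H integer_group" and fbij: "bij_betw f (carrier ?H) (carrier integer_group)"
    by (auto simp: iso_def)
  have cl: "?cl \<in> hom ?Z ?H"
    using normal.r_coset_hom_Mod[OF normal_subgroup_singular_relboundary_relcycle, of p X "{}"]
    unfolding right_coset_singular_relboundary nontrivial_relative_homology_group .
  have carrier: "?cl c \<in> carrier ?H" if "singular_relcycle p X {} c" for c
    using that by (auto simp: carrier_relative_homology_group)
  show thesis
  proof
    fix c d assume cd: "singular_relcycle p X {} c" "singular_relcycle p X {} d"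
    then have "?cl (c + d) = ?cl c \<otimes>\<^bsub>?H\<^esub> ?cl d" using hom_mult[OF cl, of c d] by simp
    then show "f (?cl (c + d)) = f (?cl c) + f (?cl d)"
      using hom_mult[OF fhom carrier[OF cd(1)] carrier[OF cd(2)]] by simp
  next
    fix c assume c: "singular_relcycle p X {} c"
    have one: "f \<one>\<^bsub>?H\<^esub> = 0" using hom_one[OF fhom] by simp
    have "f (?cl c) = 0 \<longleftrightarrow> ?cl c = \<one>\<^bsub>?H\<^esub>"
      using bij_betw_imp_inj_on[OF fbij] one carrier[OF c]
        group.is_monoid[OF group_relative_homology_group, THEN monoid.one_closed, of "int p" X "{}"]
      by (metis inj_on_contraD)
    also have "\<dots> \<longleftrightarrow> singular_relboundary p X {} c"
      by (simp add: homologous_rel_set_eq_relboundary)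
    finally show "f (?cl c) = 0 \<longleftrightarrow> singular_relboundary p X {} c" .
  next
    have "1 \<in> f ` carrier ?H" using fbij by (simp add: bij_betw_def)
    then show "\<exists>z. singular_relcycle p X {} z \<and> f (?cl z) = 1"
      by (auto simp: carrier_relative_homology_group)
  qed
qed

text \<open>A cycle \<open>z\<close> whose class generates the homology group is separated by a cocycle from the boundaries,
while coboundaries vanish on all cycles. To apply the separation lemma, suppose that
\<open>n z = b + q y\<close> with a boundary \<open>b\<close> and \<open>q\<close> the characteristic of the field. If \<open>q = 0\<close>, then \<open>n = 0\<close>;
otherwise \<open>y\<close> is a cycle because chains have no torsion, and comparing homology classes shows that
\<open>q\<close> divides \<open>n\<close>.\<close>

lemma not_singular_cohomology_vanishes:
  assumes iso: "homology_group (int p) X \<cong> integer_group" and "p \<ge> 1"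
  shows "\<not> singular_cohomology_vanishes TYPE('k::field) p X"
proof
  assume vanish: "singular_cohomology_vanishes TYPE('k) p X"
  let ?Z = "singular_relcycle p X {}" and ?B = "singular_relboundary p X {}"
  obtain F where Fadd: "\<And>c d. ?Z c \<Longrightarrow> ?Z d \<Longrightarrow> F (c + d) = F c + (F d :: int)"
    and F0: "\<And>c. ?Z c \<Longrightarrow> F c = 0 \<longleftrightarrow> ?B c" and "\<exists>z. ?Z z \<and> F z = 1"
    using homology_coordinate[OF iso] by metis
  then obtain z where z: "?Z z" "F z = 1" by blast
  have Fcmul: "F (frag_cmul n c) = n * F c" if c: "?Z c" for n c
  proof (induction n rule: int_induct[where k = 0])
    case base
    then show ?case using F0[of 0] by simp
  next
    case (step1 i)
    have "F (frag_cmul i c + c) = F (frag_cmul i c) + F c"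
      by (rule Fadd) (use c in \<open>simp_all add: singular_relcycle_cmul\<close>)
    then show ?case using step1 by (simp add: frag_cmul_distrib algebra_simps)
  next
    case (step2 i)
    have "F (frag_cmul (i - 1) c + c) = F (frag_cmul (i - 1) c) + F c"
      by (rule Fadd) (use c in \<open>simp_all add: singular_relcycle_cmul\<close>)
    then show ?case using step2 by (simp add: frag_cmul_diff_distrib algebra_simps)
  qed
  define B where "B = {b + frag_cmul (int CHAR('k)) y | b y. ?B b}"
  have "of_int n = (0 :: 'k)" if nz: "frag_cmul n z \<in> B" for n
  proof -
    obtain b y where b: "?B b" and eq: "frag_cmul n z = b + frag_cmul (int CHAR('k)) y"
      using nz unfolding B_def by blast
    have Zb: "?Z b" using b singular_relboundary_imp_relcycle by blast
    have Zy: "?Z (frag_cmul (int CHAR('k)) y)"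
      using singular_relcycle_diff[OF singular_relcycle_cmul[OF z(1), of n] Zb] by (simp add: eq)
    have "CHAR('k) = 0 \<or> ?Z y"
      using Zy by (auto simp: singular_cycle chain_boundary_cmul singular_chain_def)
    then have "int CHAR('k) dvd F (frag_cmul (int CHAR('k)) y)"
      using Fcmul[of y "int CHAR('k)"] Fcmul[OF z(1), of 0] by auto
    moreover have "n = F b + F (frag_cmul (int CHAR('k)) y)"
      using Fcmul[OF z(1), of n] Fadd[OF Zb Zy] z(2) eq by simp
    moreover have "F b = 0" using F0[OF Zb] b by simp
    ultimately show ?thesis by (simp add: of_int_eq_0_iff_char_dvd)
  qed
  moreover have "0 \<in> B"
    unfolding B_def by (intro CollectI exI[of _ 0]) simp
  moreover have "u - v \<in> B" if uv: "u \<in> B" "v \<in> B" for u v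
  proof -
    obtain b y b' y' where "?B b" "?B b'" and u: "u = b + frag_cmul (int CHAR('k)) y"
      and v: "v = b' + frag_cmul (int CHAR('k)) y'"
      using uv unfolding B_def by blast
    then have "?B (b - b')" by (simp add: singular_relboundary_diff)
    moreover have "u - v = (b - b') + frag_cmul (int CHAR('k)) (y - y')"
      by (intro poly_mapping_eqI) (simp add: u v lookup_minus lookup_add algebra_simps)
    ultimately show ?thesis unfolding B_def by blast
  qed
  moreover have "frag_cmul (int CHAR('k)) x \<in> B" for x
    unfolding B_def by (intro CollectI exI[of _ 0] exI[of _ x]) simp
  ultimately obtain \<phi> :: "'a chain \<Rightarrow> 'k" where \<phi>diff: "\<And>x y. \<phi> (x - y) = \<phi> x - \<phi> y"
    and \<phi>z: "\<phi> z = 1" and \<phi>B: "\<And>b. b \<in> B \<Longrightarrow> \<phi> b = 0"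
    using additive_functional_exists[of B z] by metis
  define f where "f s = \<phi> (frag_of s)" for s
  have "singular_coboundary p f s = 0" if "singular_simplex (Suc p) X s" for s
  proof -
    have "?B (chain_boundary (Suc p) (frag_of s))"
      unfolding singular_boundary using that singular_chain_of by blast
    then have "chain_boundary (Suc p) (frag_of s) \<in> B"
      unfolding B_def by (intro CollectI exI[of _ "chain_boundary (Suc p) (frag_of s)"] exI[of _ 0]) simp
    then show ?thesis
      unfolding f_def additive_chain_boundary[OF \<phi>diff, symmetric] by (rule \<phi>B)
  qed
  moreover obtain q where q: "p = Suc q" using \<open>p \<ge> 1\<close> by (cases p) auto
  ultimately obtain g :: "((nat \<Rightarrow> real) \<Rightarrow> 'a) \<Rightarrow> 'k"
    where g: "\<And>s. singular_simplex p X s \<Longrightarrow> f s = singular_coboundary q g s"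
    using vanish unfolding singular_cohomology_vanishes_def by fastforce
  have "\<phi> c = chain_eval g (chain_boundary p c)" if "singular_chain p X c" for c
    using that unfolding singular_chain_def
  proof (induction c rule: frag_induction)
    case zero
    then show ?case using \<phi>diff[of 0 0] by (simp add: chain_eval_def)
  next
    case (one s)
    then have "\<phi> (frag_of s) = singular_coboundary q g s" using g by (simp add: f_def)
    also have "\<dots> = chain_eval g (chain_boundary p (frag_of s))"
      unfolding q additive_chain_boundary[of "chain_eval g", OF chain_eval_diff] by simp
    finally show ?case .
  next
    case (diff a b)
    then show ?case by (simp add: \<phi>diff chain_boundary_diff chain_eval_diff)
  qed
  then have "\<phi> z = chain_eval g 0" using z(1) by (metis singular_cycle)
  then show False using \<phi>z by (simp add: chain_eval_def)
qed

section \<open>Punctured Euclidean spaces\<close>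

definition punctured :: "nat \<Rightarrow> (nat \<Rightarrow> real) set" where
  "punctured n = {x. (\<forall>i\<ge>n. x i = 0) \<and> x \<noteq> (\<lambda>_. 0)}"

lemma punctured_homotopy_equivalent_nsphere:
  "subtopology (powertop_real UNIV) (punctured (Suc n)) homotopy_equivalent_space nsphere n"
proof -
  let ?X = "subtopology (powertop_real UNIV) (punctured (Suc n))"
  define N where "N x = sqrt (\<Sum>j\<le>n. (x j)\<^sup>2)" for x :: "nat \<Rightarrow> real"
  define f where "f x = (\<lambda>i. x i / N x)" for x
  have N: "N x > 0" if x: "x \<in> punctured (Suc n)" for x
  proof -
    obtain i where i: "x i \<noteq> 0" using x by (auto simp: punctured_def)
    then have "i \<le> n" using x by (auto simp: punctured_def Suc_le_eq)
    then have "(x i)\<^sup>2 \<le> (\<Sum>j\<le>n. (x j)\<^sup>2)" by (intro member_le_sum) auto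
    moreover have "0 < (x i)\<^sup>2" using i by simp
    ultimately have "0 < (\<Sum>j\<le>n. (x j)\<^sup>2)" by linarith
    then show ?thesis by (simp add: N_def)
  qed
  have sphere: "topspace (nsphere n) = {x. N x = 1 \<and> (\<forall>i>n. x i = 0)}"
    by (auto simp: nsphere N_def)
  have sub: "topspace (nsphere n) \<subseteq> punctured (Suc n)"
  proof
    fix x assume x: "x \<in> topspace (nsphere n)"
    have "N (\<lambda>_. 0) = 0" by (simp add: N_def)
    then have "x \<noteq> (\<lambda>_. 0)" using x by (auto simp: sphere)
    then show "x \<in> punctured (Suc n)" using x by (auto simp: sphere punctured_def)
  qed
  have coord: "continuous_map (subtopology (powertop_real UNIV) T) euclideanreal (\<lambda>x. x i)"
    for T and i :: nat
    by (intro continuous_map_from_subtopology continuous_map_product_projection UNIV_I)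
  have Ncont: "continuous_map ?X euclideanreal N"
    unfolding N_def by (intro continuous_intros coord) auto
  have fcont: "continuous_map ?X (nsphere n) f"
    unfolding nsphere continuous_map_in_subtopology
  proof
    show "continuous_map ?X (powertop_real UNIV) f"
      unfolding continuous_map_componentwise_UNIV f_def
      by (intro allI continuous_map_real_divide coord Ncont) (use N in fastforce)
    have "(\<Sum>i\<le>n. (f x i)\<^sup>2) = 1" if "x \<in> punctured (Suc n)" for x
    proof -
      have "(\<Sum>i\<le>n. (f x i)\<^sup>2) = (\<Sum>i\<le>n. (x i)\<^sup>2) / (N x)\<^sup>2"
        by (simp add: f_def power_divide sum_divide_distrib)
      also have "(N x)\<^sup>2 = (\<Sum>i\<le>n. (x i)\<^sup>2)" by (simp add: N_def sum_nonneg)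
      finally show ?thesis using N[OF that] by (simp add: N_def)
    qed
    then show "f \<in> topspace ?X \<rightarrow> {x. (\<Sum>i\<le>n. (x i)\<^sup>2) = 1 \<and> (\<forall>i>n. x i = 0)}"
      by (auto simp: f_def punctured_def)
  qed
  have idcont: "continuous_map (nsphere n) ?X id"
    unfolding continuous_map_in_subtopology using sub
    by (auto simp: nsphere continuous_map_from_subtopology)
  have "homotopic_with (\<lambda>x. True) ?X ?X f id"
  proof -
    let ?h = "\<lambda>(t, x) i. x i * ((1 - t) / N x + t)"
    have "continuous_map (prod_topology (top_of_set {0..1}) ?X) (powertop_real UNIV) ?h"
      unfolding continuous_map_componentwise_UNIV case_prod_unfold
    proof
      fix i
      have t: "continuous_map (prod_topology (top_of_set {0..1}) ?X) euclideanreal fst"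
        by (rule continuous_map_into_fulltopology[OF continuous_map_fst])
      have "continuous_map (prod_topology (top_of_set {0..1}) ?X) euclideanreal ((\<lambda>x. x i) \<circ> snd)"
        "continuous_map (prod_topology (top_of_set {0..1}) ?X) euclideanreal (N \<circ> snd)"
        by (rule continuous_map_compose[OF continuous_map_snd] coord Ncont)+
      then have *: "continuous_map (prod_topology (top_of_set {0..1}) ?X) euclideanreal (\<lambda>z. snd z i)"
        "continuous_map (prod_topology (top_of_set {0..1}) ?X) euclideanreal (\<lambda>z. N (snd z))"
        by (simp_all add: o_def)
      show "continuous_map (prod_topology (top_of_set {0..1}) ?X) euclideanreal
          (\<lambda>z. snd z i * ((1 - fst z) / N (snd z) + fst z))"
        by (intro continuous_map_real_mult continuous_map_add continuous_map_real_divide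
            continuous_map_diff * t continuous_map_const[THEN iffD2] disjI2) (auto dest: N)
    qed
    moreover have "?h (t, x) \<in> punctured (Suc n)" if t: "0 \<le> t" "t \<le> 1" and x: "x \<in> punctured (Suc n)" for t x
    proof -
      obtain i where i: "x i \<noteq> 0" using x by (auto simp: punctured_def)
      have "(1 - t) / N x + t > 0"
      proof (cases "t = 0")
        case False
        then show ?thesis using t N[OF x] by (intro add_nonneg_pos divide_nonneg_pos) auto
      qed (use N[OF x] in auto)
      then have "x i * ((1 - t) / N x + t) \<noteq> 0" using i by simp
      then have "?h (t, x) \<noteq> (\<lambda>_. 0)" by (auto simp: fun_eq_iff)
      then show ?thesis using x by (auto simp: punctured_def)
    qed
    ultimately have "continuous_map (prod_topology (top_of_set {0..1}) ?X) ?X ?h"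
      by (auto simp: continuous_map_in_subtopology)
    then show ?thesis
      by (simp add: homotopic_with) (rule exI[of _ ?h], simp add: f_def)
  qed
  then have "homotopic_with (\<lambda>x. True) ?X ?X (id \<circ> f) id" by simp
  moreover have "homotopic_with (\<lambda>x. True) (nsphere n) (nsphere n) (f \<circ> id) id"
  proof (rule homotopic_with_equal)
    show "continuous_map (nsphere n) (nsphere n) (f \<circ> id)"
      by (rule continuous_map_compose[OF idcont fcont])
  qed (auto simp: f_def sphere)
  ultimately show ?thesis
    unfolding homotopy_equivalent_space_def using fcont idcont by blast
qed

text \<open>The punctured line is disconnected; in higher dimensions the homology of the sphere decides.\<close>

lemma not_acyclic_punctured:
  assumes "n \<ge> 1"
  shows "\<not> acyclic_space TYPE('k::field) (subtopology (powertop_real UNIV) (punctured n))"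
proof (cases "n = 1")
  case True
  let ?X = "subtopology (powertop_real UNIV) (punctured n)"
  have "\<not> path_connected_space ?X"
  proof
    assume "path_connected_space ?X"
    then have "connectedin ?X (topspace ?X)"
      using path_connected_imp_connected_space connectedin_topspace by blast
    moreover have "continuous_map ?X euclideanreal (\<lambda>x. x 0)"
      by (intro continuous_map_from_subtopology continuous_map_product_projection UNIV_I)
    ultimately have conn: "connected ((\<lambda>x. x 0) ` punctured n)"
      using connectedin_continuous_map_image by fastforce
    have mem: "s \<in> (\<lambda>x. x 0) ` punctured n" if "s \<noteq> 0" for s :: real
      using that True by (intro image_eqI[of _ _ "\<lambda>i. if i = 0 then s else 0"]) (auto simp: punctured_def fun_eq_iff)
    \<comment> \<open>The intermediate value between \<open>- 1\<close> and \<open>1\<close> would be taken at the missing point.\<close>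
    have "0 \<in> (\<lambda>x. x 0) ` punctured n"
      by (rule connectedD_interval[OF conn mem[of "- 1"] mem[of 1]]) auto
    then obtain x where "x 0 = 0" "x \<in> punctured n" by auto
    then show False using True by (auto simp: punctured_def fun_eq_iff) (metis One_nat_def Suc_leI not_gr_zero)
  qed
  then show ?thesis by (simp add: acyclic_space_def)
next
  case False
  then obtain m where m: "n = Suc m" "m \<ge> 1" using assms by (cases n) auto
  let ?X = "subtopology (powertop_real UNIV) (punctured n)"
  have "homology_group (int m) ?X \<cong> homology_group (int m) (nsphere m)"
    unfolding m(1)
    by (rule homotopy_equivalent_space_imp_isomorphic_homology_groups[OF punctured_homotopy_equivalent_nsphere])
  also have "homology_group (int m) (nsphere m) \<cong> integer_group"
    using reduced_homology_group_nsphere(1)[of m] m(2) by (simp add: un_reduced_homology_group)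
  finally have "\<not> singular_cohomology_vanishes TYPE('k) m ?X"
    by (intro not_singular_cohomology_vanishes m(2))
  then show ?thesis using m(2) by (auto simp: acyclic_space_def)
qed

section \<open>Normal forms of points of the quotient space\<close>

lemma continuous_on_Min:
  fixes f :: "'i \<Rightarrow> 'a::topological_space \<Rightarrow> real"
  assumes "finite I" and "I \<noteq> {}" and "\<And>i. i \<in> I \<Longrightarrow> continuous_on S (f i)"
  shows "continuous_on S (\<lambda>x. Min ((\<lambda>i. f i x) ` I))"
  using assms
proof (induction I rule: finite_ne_induct)
  case (insert i I)
  then have "continuous_on S (\<lambda>x. min (f i x) (Min ((\<lambda>i. f i x) ` I)))"
    by (intro continuous_on_min) auto
  then show ?case using insert.hyps by simp
qed simp

text \<open>The representatives of the points of \<open>V\<^sup>>(R)\<close> that vanish at some \<open>u\<^sub>i\<close> and at some \<open>v\<^sub>j\<close>. Their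
supports are exactly the nonempty ray sets of the cones of the fan within \<open>R\<close>, so these are the
vectors by which \<open>V\<^sup>>(R)\<close> is defined.\<close>

definition normal_forms :: "nat \<Rightarrow> nat \<Rightarrow> ray set \<Rightarrow> (ray \<Rightarrow> real) set" where
  "normal_forms l1 l2 R = {w. (\<forall>r. 0 \<le> w r) \<and> (\<forall>r. r \<notin> R \<longrightarrow> w r = 0) \<and> w \<noteq> (\<lambda>_. 0) \<and>
     (\<exists>i\<in>{1..l1}. w (URay i) = 0) \<and> (\<exists>j\<in>{1..l2}. w (VRay j) = 0)}"

lemma V_gt_eq_normal_forms:
  assumes "R \<subseteq> rays l1 l2"
  shows "V_gt l1 l2 c R = N_class l1 l2 c ` normal_forms l1 l2 R"
proof (intro equalityI subsetI)
  fix P assume "P \<in> V_gt l1 l2 c R"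
  then obtain t w S where P: "P = N_class l1 l2 c (\<lambda>r. t * w r)" and t: "t > 0" and S: "S \<in> fan l1 l2"
    and w: "\<forall>r. 0 \<le> w r" "\<forall>r. r \<notin> R \<inter> S \<longrightarrow> w r = 0" "(\<Sum>r\<in>R \<inter> S. w r) = 1"
    unfolding V_gt_def by blast
  obtain i j where ij: "i \<in> {1..l1}" "j \<in> {1..l2}" "S \<subseteq> rays l1 l2 - {URay i, VRay j}"
    using S unfolding fan_def max_cones_def by blast
  then have "URay i \<notin> S" "VRay j \<notin> S" by blast+
  then have "w (URay i) = 0" "w (VRay j) = 0" using w(2) by blast+
  moreover have "(\<lambda>r. t * w r) \<noteq> (\<lambda>_. 0)"
  proof
    assume "(\<lambda>r. t * w r) = (\<lambda>_. 0)"
    then have "w r = 0" for r using t by (metis mult_eq_0_iff less_irrefl)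
    then show False using w(3) by simp
  qed
  ultimately have "(\<lambda>r. t * w r) \<in> normal_forms l1 l2 R"
    using w t ij(1,2) unfolding normal_forms_def by auto
  then show "P \<in> N_class l1 l2 c ` normal_forms l1 l2 R" using P by blast
next
  fix P assume "P \<in> N_class l1 l2 c ` normal_forms l1 l2 R"
  then obtain w where P: "P = N_class l1 l2 c w" and w: "w \<in> normal_forms l1 l2 R" by blast
  have nn: "\<And>r. 0 \<le> w r" and supp: "\<And>r. r \<notin> R \<Longrightarrow> w r = 0" and nz: "w \<noteq> (\<lambda>_. 0)"
    using w by (auto simp: normal_forms_def)
  obtain i j where ij: "i \<in> {1..l1}" "j \<in> {1..l2}" "w (URay i) = 0" "w (VRay j) = 0"
    using w unfolding normal_forms_def by blast
  define S where "S = {r. w r \<noteq> 0}"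
  have SR: "S \<subseteq> R" using supp by (auto simp: S_def)
  have "S \<subseteq> rays l1 l2 - {URay i, VRay j}" using SR assms ij(3,4) by (auto simp: S_def)
  then have fan: "S \<in> fan l1 l2" using ij(1,2) unfolding fan_def max_cones_def by blast
  define t where "t = (\<Sum>r\<in>S. w r)"
  have "finite S" using SR assms by (meson finite_rays finite_subset)
  moreover have "S \<noteq> {}" using nz by (auto simp: S_def)
  ultimately have t: "t > 0" unfolding t_def
    by (intro sum_pos) (auto simp: S_def nn order.not_eq_order_implies_strict)
  have RS: "R \<inter> S = S" using SR by blast
  have "P = N_class l1 l2 c (\<lambda>r. t * (w r / t))" using P t by simp
  moreover have "(\<Sum>r\<in>R \<inter> S. w r / t) = 1" using t by (simp add: RS t_def flip: sum_divide_distrib)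
  ultimately show "P \<in> V_gt l1 l2 c R"
    unfolding V_gt_def using t fan nn supp
    by (intro CollectI exI[of _ t] exI[of _ "\<lambda>r. w r / t"] conjI bexI[of _ S]) (auto simp: RS S_def)
qed

lemma N_class_eq_iff:
  "N_class l1 l2 c x = N_class l1 l2 c y \<longleftrightarrow>
    (\<exists>s t. y = (\<lambda>r. x r + s * of_int (relation1 l1 l2 c r) + t * of_int (relation2 l1 l2 r)))"
proof
  assume eq: "N_class l1 l2 c x = N_class l1 l2 c y"
  have "y \<in> N_class l1 l2 c y"
    unfolding N_class_def by (intro CollectI exI[of _ 0]) simp
  then show "\<exists>s t. y = (\<lambda>r. x r + s * of_int (relation1 l1 l2 c r) + t * of_int (relation2 l1 l2 r))"
    unfolding eq[symmetric] unfolding N_class_def by blast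
next
  assume "\<exists>s t. y = (\<lambda>r. x r + s * of_int (relation1 l1 l2 c r) + t * of_int (relation2 l1 l2 r))"
  then obtain s t where y: "y = (\<lambda>r. x r + s * of_int (relation1 l1 l2 c r) + t * of_int (relation2 l1 l2 r))"
    by blast
  show "N_class l1 l2 c x = N_class l1 l2 c y"
  proof (intro equalityI subsetI)
    fix z assume "z \<in> N_class l1 l2 c x"
    then obtain s' t' where
      "z = (\<lambda>r. x r + s' * of_int (relation1 l1 l2 c r) + t' * of_int (relation2 l1 l2 r))"
      unfolding N_class_def by blast
    then have "z = (\<lambda>r. y r + (s' - s) * of_int (relation1 l1 l2 c r) + (t' - t) * of_int (relation2 l1 l2 r))"
      by (simp add: y algebra_simps)
    then show "z \<in> N_class l1 l2 c y" unfolding N_class_def by blast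
  next
    fix z assume "z \<in> N_class l1 l2 c y"
    then obtain s' t' where
      "z = (\<lambda>r. y r + s' * of_int (relation1 l1 l2 c r) + t' * of_int (relation2 l1 l2 r))"
      unfolding N_class_def by blast
    then have "z = (\<lambda>r. x r + (s' + s) * of_int (relation1 l1 l2 c r) + (t' + t) * of_int (relation2 l1 l2 r))"
      by (simp add: y algebra_simps)
    then show "z \<in> N_class l1 l2 c x" unfolding N_class_def by blast
  qed
qed

definition u_min :: "nat \<Rightarrow> (ray \<Rightarrow> real) \<Rightarrow> real" where
  "u_min l1 x = Min ((\<lambda>i. x (URay i)) ` {1..l1})"

definition v_min :: "nat \<Rightarrow> nat \<Rightarrow> (nat \<Rightarrow> int) \<Rightarrow> (ray \<Rightarrow> real) \<Rightarrow> real" where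
  "v_min l1 l2 c x = Min ((\<lambda>j. x (VRay j) - u_min l1 x * of_int (c j)) ` {1..l2})"

text \<open>Subtracting the right multiple of the first relation makes the smallest \<open>u\<close>-coordinate zero; the
second relation then does the same for the \<open>v\<close>-coordinates without changing the \<open>u\<close>-coordinates.\<close>

definition normalize :: "nat \<Rightarrow> nat \<Rightarrow> (nat \<Rightarrow> int) \<Rightarrow> (ray \<Rightarrow> real) \<Rightarrow> ray \<Rightarrow> real" where
  "normalize l1 l2 c x =
     (\<lambda>r. x r - u_min l1 x * of_int (relation1 l1 l2 c r) - v_min l1 l2 c x * of_int (relation2 l1 l2 r))"

lemma normalize_cong:
  assumes "l1 \<ge> 1" and "l2 \<ge> 1" and "N_class l1 l2 c x = N_class l1 l2 c y"
  shows "normalize l1 l2 c x = normalize l1 l2 c y"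
proof -
  obtain s t where y: "y = (\<lambda>r. x r + s * of_int (relation1 l1 l2 c r) + t * of_int (relation2 l1 l2 r))"
    using assms(3) unfolding N_class_eq_iff by blast
  have yU: "y (URay i) = x (URay i) + s" if "i \<in> {1..l1}" for i
    using that by (simp add: y relation1_def relation2_def rays_def)
  have yV: "y (VRay j) = x (VRay j) + s * of_int (c j) + t" if "j \<in> {1..l2}" for j
    using that by (simp add: y relation1_def relation2_def rays_def image_iff)
  have "u_min l1 y = Min ((\<lambda>i. x (URay i) + s) ` {1..l1})"
    unfolding u_min_def using yU by (intro arg_cong[of _ _ Min] image_cong) auto
  also have "\<dots> = u_min l1 x + s"
    unfolding u_min_def using assms(1) by (intro Min_add_commute) auto
  finally have u: "u_min l1 y = u_min l1 x + s" .
  have "v_min l1 l2 c y = Min ((\<lambda>j. (x (VRay j) - u_min l1 x * of_int (c j)) + t) ` {1..l2})"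
    unfolding v_min_def u using yV by (intro arg_cong[of _ _ Min] image_cong) (auto simp: algebra_simps)
  also have "\<dots> = v_min l1 l2 c x + t"
    unfolding v_min_def using assms(2) by (intro Min_add_commute) auto
  finally have v: "v_min l1 l2 c y = v_min l1 l2 c x + t" .
  show ?thesis unfolding normalize_def u v by (simp add: y algebra_simps)
qed

lemma normalize_normal_form:
  assumes "w \<in> normal_forms l1 l2 R"
  shows "normalize l1 l2 c w = w"
proof -
  obtain i j where ij: "i \<in> {1..l1}" "j \<in> {1..l2}" "w (URay i) = 0" "w (VRay j) = 0"
    and nn: "\<And>r. 0 \<le> w r"
    using assms unfolding normal_forms_def by blast
  have u: "u_min l1 w = 0"
    unfolding u_min_def by (rule Min_eqI) (use ij nn in \<open>auto intro!: image_eqI[of 0 _ i]\<close>)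
  have "v_min l1 l2 c w = 0"
    unfolding v_min_def u by (rule Min_eqI) (use ij nn in \<open>auto intro!: image_eqI[of 0 _ j]\<close>)
  with u show ?thesis by (simp add: normalize_def)
qed

lemma continuous_map_normalize:
  assumes "l1 \<ge> 1" and "l2 \<ge> 1"
  shows "continuous_map (ray_space l1 l2) (powertop_real UNIV) (normalize l1 l2 c)"
proof -
  have coord: "continuous_on UNIV (\<lambda>x::ray \<Rightarrow> real. x r)" for r
    by (rule continuous_on_product_coordinates)
  have u: "continuous_on UNIV (u_min l1)"
    unfolding u_min_def using assms(1) by (intro continuous_on_Min coord) auto
  have v: "continuous_on UNIV (v_min l1 l2 c)"
    unfolding v_min_def using assms(2) by (intro continuous_on_Min continuous_intros coord u) auto
  have "continuous_on UNIV (normalize l1 l2 c)"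
    unfolding normalize_def
    by (intro continuous_on_coordinatewise_then_product continuous_intros coord u v)
  then have "continuous_map (powertop_real UNIV) (powertop_real UNIV) (normalize l1 l2 c)"
    by (simp add: euclidean_product_topology)
  then show ?thesis unfolding ray_space_def by (rule continuous_map_from_subtopology)
qed

text \<open>The inverse of the quotient map on normal forms is induced by \<open>normalize\<close>, which is continuous and
constant on cosets.\<close>

lemma V_gt_homeomorphic_normal_forms:
  assumes "l1 \<ge> 1" and "l2 \<ge> 1" and R: "R \<subseteq> rays l1 l2"
  shows "subtopology (N_space l1 l2 c) (V_gt l1 l2 c R) homeomorphic_space
    subtopology (powertop_real UNIV) (normal_forms l1 l2 R)"
proof -
  obtain g where g: "continuous_map (N_space l1 l2 c) (powertop_real UNIV) g"
    and gN: "\<And>x. x \<in> topspace (ray_space l1 l2) \<Longrightarrow> g (N_class l1 l2 c x) = normalize l1 l2 c x"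
    using quotient_map_lift_exists[OF quotient_map_N_class continuous_map_normalize[OF assms(1,2)]]
      normalize_cong[OF assms(1,2)] by metis
  have sub: "normal_forms l1 l2 R \<subseteq> topspace (ray_space l1 l2)"
    using R by (auto simp: normal_forms_def ray_space_def)
  have gw: "g (N_class l1 l2 c w) = w" if "w \<in> normal_forms l1 l2 R" for w
    using gN that sub normalize_normal_form[OF that] by auto
  have "continuous_map (subtopology (N_space l1 l2 c) (V_gt l1 l2 c R))
      (subtopology (powertop_real UNIV) (normal_forms l1 l2 R)) g"
    unfolding continuous_map_in_subtopology
  proof
    show "g \<in> topspace (subtopology (N_space l1 l2 c) (V_gt l1 l2 c R)) \<rightarrow> normal_forms l1 l2 R"
      by (auto simp: V_gt_eq_normal_forms[OF R] gw)
  qed (rule continuous_map_from_subtopology[OF g])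
  moreover have "continuous_map (subtopology (powertop_real UNIV) (normal_forms l1 l2 R))
      (subtopology (N_space l1 l2 c) (V_gt l1 l2 c R)) (N_class l1 l2 c)"
    unfolding continuous_map_in_subtopology
  proof
    have "subtopology (powertop_real UNIV) (normal_forms l1 l2 R) =
        subtopology (ray_space l1 l2) (normal_forms l1 l2 R)"
      using sub by (simp add: ray_space_def subtopology_subtopology Int_absorb1)
    then show "continuous_map (subtopology (powertop_real UNIV) (normal_forms l1 l2 R))
        (N_space l1 l2 c) (N_class l1 l2 c)"
      using continuous_map_from_subtopology[OF quotient_imp_continuous_map[OF quotient_map_N_class]] by metis
  qed (auto simp: V_gt_eq_normal_forms[OF R])
  ultimately have "homeomorphic_maps (subtopology (N_space l1 l2 c) (V_gt l1 l2 c R))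
      (subtopology (powertop_real UNIV) (normal_forms l1 l2 R)) g (N_class l1 l2 c)"
    unfolding homeomorphic_maps_def by (auto simp: V_gt_eq_normal_forms[OF R] gw)
  then show ?thesis unfolding homeomorphic_space_def by blast
qed

section \<open>The tempting sets of rays\<close>

text \<open>If one of the families is met but not contained in \<open>R\<close>, the normal forms are star-shaped around any ray
of \<open>R\<close> in that family: moving towards this ray keeps the zero coordinates of the other family, and
in its own family the coordinates at the rays outside \<open>R\<close> stay zero.\<close>

lemma acyclic_normal_forms:
  assumes R: "R \<subseteq> rays l1 l2" "R \<notin> whole_families l1 l2" and l: "l1 \<ge> 1" "l2 \<ge> 1"
  shows "acyclic_space TYPE('k::field) (subtopology (powertop_real UNIV) (normal_forms l1 l2 R))"
proof -
  have star: "acyclic_space TYPE('k::field) (subtopology (powertop_real UNIV) (normal_forms l1 l2 R))"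
    if "r \<in> R"
      and keepU: "(\<exists>i\<in>{1..l1}. URay i \<notin> R) \<or> (\<exists>j. r = VRay j)"
      and keepV: "(\<exists>j\<in>{1..l2}. VRay j \<notin> R) \<or> (\<exists>i. r = URay i)" for r
  proof (rule acyclic_space_star_shaped)
    let ?e = "\<lambda>s. if s = r then 1 else 0 :: real"
    have U: "\<exists>i\<in>{1..l1}. t * ?e (URay i) + (1 - t) * w (URay i) = 0"
      if "\<forall>s. s \<notin> R \<longrightarrow> w s = 0" "\<exists>i\<in>{1..l1}. w (URay i) = 0" for w t
      using keepU
    proof
      assume "\<exists>i\<in>{1..l1}. URay i \<notin> R"
      then obtain i where "i \<in> {1..l1}" "URay i \<notin> R" by blast
      then show ?thesis using \<open>r \<in> R\<close> that(1) by (intro bexI[of _ i]) auto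
    next
      assume "\<exists>j. r = VRay j"
      then show ?thesis using that(2) by auto
    qed
    have V: "\<exists>j\<in>{1..l2}. t * ?e (VRay j) + (1 - t) * w (VRay j) = 0"
      if "\<forall>s. s \<notin> R \<longrightarrow> w s = 0" "\<exists>j\<in>{1..l2}. w (VRay j) = 0" for w t
      using keepV
    proof
      assume "\<exists>j\<in>{1..l2}. VRay j \<notin> R"
      then obtain j where "j \<in> {1..l2}" "VRay j \<notin> R" by blast
      then show ?thesis using \<open>r \<in> R\<close> that(1) by (intro bexI[of _ j]) auto
    next
      assume "\<exists>i. r = URay i"
      then show ?thesis using that(2) by auto
    qed
    show "?e \<in> normal_forms l1 l2 R"
    proof -
      have "\<exists>i\<in>{1..l1}. 1 * ?e (URay i) + (1 - 1) * 0 = 0"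
        using l by (intro U[of "\<lambda>_. 0" 1]) auto
      moreover have "\<exists>j\<in>{1..l2}. 1 * ?e (VRay j) + (1 - 1) * 0 = 0"
        using l by (intro V[of "\<lambda>_. 0" 1]) auto
      ultimately show ?thesis using \<open>r \<in> R\<close> by (auto simp: normal_forms_def fun_eq_iff)
    qed
    fix w and t :: real assume w: "w \<in> normal_forms l1 l2 R" and t: "0 \<le> t" "t \<le> 1"
    have nn: "\<And>s. 0 \<le> w s" and supp: "\<forall>s. s \<notin> R \<longrightarrow> w s = 0" and nz: "w \<noteq> (\<lambda>_. 0)"
      using w by (auto simp: normal_forms_def)
    have "(\<lambda>s. t * ?e s + (1 - t) * w s) \<noteq> (\<lambda>_. 0)"
    proof (cases "t = 0")
      case True
      then show ?thesis using nz by simp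
    next
      case False
      then have pos: "t * ?e r + (1 - t) * w r > 0" using t nn[of r] by (simp add: add_pos_nonneg)
      show ?thesis
      proof
        assume "(\<lambda>s. t * ?e s + (1 - t) * w s) = (\<lambda>_. 0)"
        from fun_cong[OF this, of r] show False using pos by simp
      qed
    qed
    moreover have "0 \<le> t * ?e s + (1 - t) * w s" for s using t nn[of s] by simp
    moreover have "t * ?e s + (1 - t) * w s = 0" if "s \<notin> R" for s using that supp \<open>r \<in> R\<close> by auto
    moreover have "\<exists>i\<in>{1..l1}. w (URay i) = 0" "\<exists>j\<in>{1..l2}. w (VRay j) = 0"
      using w by (auto simp: normal_forms_def)
    ultimately show "(\<lambda>s. t * ?e s + (1 - t) * w s) \<in> normal_forms l1 l2 R"
      using U[OF supp, of t] V[OF supp, of t] unfolding normal_forms_def by blast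
  qed
  define U V where "U = URay ` {1..l1}" and "V = VRay ` {1..l2}"
  have UV: "rays l1 l2 = U \<union> V" by (simp add: U_def V_def rays_def)
  have ne: "R \<noteq> {}" "R \<noteq> U" "R \<noteq> V" "R \<noteq> U \<union> V"
    using R(2) by (auto simp: whole_families_def U_def V_def rays_def)
  show ?thesis
  proof (cases "R \<inter> U = {} \<or> U \<subseteq> R")
    case True
    moreover have "R = (R \<inter> U) \<union> (R \<inter> V)" using R(1) UV by blast
    ultimately have "R \<inter> V \<noteq> {}" "\<not> V \<subseteq> R" using ne by auto
    then obtain j j' where "j \<in> {1..l2}" "VRay j \<in> R" "j' \<in> {1..l2}" "VRay j' \<notin> R"
      unfolding V_def by blast
    then show ?thesis by (intro star[of "VRay j"]) blast+
  next
    case False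
    then obtain i i' where "i \<in> {1..l1}" "URay i \<in> R" "i' \<in> {1..l1}" "URay i' \<notin> R"
      unfolding U_def by blast
    then show ?thesis by (intro star[of "URay i"]) blast+
  qed
qed

text \<open>A vector with smallest entry zero is determined by the differences of its entries to the last one,
and these are arbitrary; so each family contained in \<open>R\<close> contributes a Euclidean space of one
dimension less than the number of its rays.\<close>

lemma normal_forms_homeomorphic_punctured:
  assumes l: "l1 \<ge> 1" "l2 \<ge> 1"
    and R: "R = (if U then URay ` {1..l1} else {}) \<union> (if V then VRay ` {1..l2} else {})"
  shows "subtopology (powertop_real UNIV) (normal_forms l1 l2 R) homeomorphic_space
    subtopology (powertop_real UNIV) (punctured ((if U then l1 - 1 else 0) + (if V then l2 - 1 else 0)))"
proof -
  define m n where "m = (if U then l1 - 1 else 0)" and "n = (if V then l2 - 1 else 0)"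
  define f where "f w = (\<lambda>k. if k < m then w (URay (Suc k)) - w (URay l1)
    else if k < m + n then w (VRay (Suc (k - m))) - w (VRay l2) else 0)" for w :: "ray \<Rightarrow> real"
  \<comment> \<open>The differences, extended by zero to the last ray, and to all rays of a family outside \<open>R\<close>.\<close>
  define b where "b x i = (if i \<le> m then x (i - 1) else 0)" for x :: "nat \<Rightarrow> real" and i
  define d where "d x j = (if j \<le> n then x (m + (j - 1)) else 0)" for x :: "nat \<Rightarrow> real" and j
  define g where "g x = (\<lambda>r. case r of
      URay i \<Rightarrow> if i \<in> {1..l1} then b x i - Min (b x ` {1..l1}) else 0
    | VRay j \<Rightarrow> if j \<in> {1..l2} then d x j - Min (d x ` {1..l2}) else 0)" for x
  have fg: "f (g x) = x" if "x \<in> punctured (m + n)" for x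
  proof
    fix k
    consider "k < m" | "m \<le> k" "k < m + n" | "m + n \<le> k" by linarith
    then show "f (g x) k = x k"
    proof cases
      case 1
      then have "l1 = Suc m" using l by (auto simp: m_def split: if_splits)
      then show ?thesis using 1 by (simp add: f_def g_def b_def)
    next
      case 2
      then have "l2 = Suc n" using l by (auto simp: n_def split: if_splits)
      then show ?thesis using 2 by (simp add: f_def g_def d_def)
    next
      case 3
      then show ?thesis using that by (simp add: f_def punctured_def)
    qed
  qed
  have gf: "g (f w) = w" if w: "w \<in> normal_forms l1 l2 R" for w
  proof
    obtain i j where ij: "i \<in> {1..l1}" "j \<in> {1..l2}" "w (URay i) = 0" "w (VRay j) = 0"
      and nn: "\<And>r. 0 \<le> w r" and supp: "\<And>r. r \<notin> R \<Longrightarrow> w r = 0"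
      using w unfolding normal_forms_def by blast
    have b: "b (f w) i = w (URay i) + - w (URay l1)" if "i \<in> {1..l1}" for i
    proof (cases U)
      case True
      then show ?thesis using that by (cases "i = l1") (auto simp: b_def f_def m_def)
    next
      case False
      then have "URay i \<notin> R" "URay l1 \<notin> R" by (auto simp: R)
      then show ?thesis using False that by (simp add: supp b_def m_def)
    qed
    have d: "d (f w) j = w (VRay j) + - w (VRay l2)" if "j \<in> {1..l2}" for j
    proof (cases V)
      case True
      then show ?thesis using that by (cases "j = l2") (auto simp: d_def f_def n_def)
    next
      case False
      then have "VRay j \<notin> R" "VRay l2 \<notin> R" by (auto simp: R)
      then show ?thesis using False that by (simp add: supp d_def n_def)
    qed
    have "Min (b (f w) ` {1..l1}) = Min ((\<lambda>i. w (URay i) + - w (URay l1)) ` {1..l1})"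
      using b by (intro arg_cong[of _ _ Min] image_cong) auto
    also have "\<dots> = Min ((\<lambda>i. w (URay i)) ` {1..l1}) + - w (URay l1)"
      using l by (intro Min_add_commute) auto
    also have "Min ((\<lambda>i. w (URay i)) ` {1..l1}) = 0"
      by (rule Min_eqI) (use ij nn in \<open>auto intro!: image_eqI[of 0 _ i]\<close>)
    finally have bmin: "Min (b (f w) ` {1..l1}) = - w (URay l1)" by simp
    have "Min (d (f w) ` {1..l2}) = Min ((\<lambda>j. w (VRay j) + - w (VRay l2)) ` {1..l2})"
      using d by (intro arg_cong[of _ _ Min] image_cong) auto
    also have "\<dots> = Min ((\<lambda>j. w (VRay j)) ` {1..l2}) + - w (VRay l2)"
      using l by (intro Min_add_commute) auto
    also have "Min ((\<lambda>j. w (VRay j)) ` {1..l2}) = 0"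
      by (rule Min_eqI) (use ij nn in \<open>auto intro!: image_eqI[of 0 _ j]\<close>)
    finally have dmin: "Min (d (f w) ` {1..l2}) = - w (VRay l2)" by simp
    fix r
    show "g (f w) r = w r"
    proof (cases r)
      case (URay i)
      show ?thesis
      proof (cases "i \<in> {1..l1}")
        case True
        then have "g (f w) r = b (f w) i - Min (b (f w) ` {1..l1})"
          by (simp only: g_def URay ray.case if_True)
        then show ?thesis unfolding b[OF True] bmin URay by simp
      next
        case False
        then have "r \<notin> R" by (auto simp: R URay)
        then show ?thesis using False by (auto simp: g_def URay supp)
      qed
    next
      case (VRay j)
      show ?thesis
      proof (cases "j \<in> {1..l2}")
        case True
        then have "g (f w) r = d (f w) j - Min (d (f w) ` {1..l2})"
          by (simp only: g_def VRay ray.case if_True)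
        then show ?thesis unfolding d[OF True] dmin VRay by simp
      next
        case False
        then have "r \<notin> R" by (auto simp: R VRay)
        then show ?thesis using False by (auto simp: g_def VRay supp)
      qed
    qed
  qed
  have f0: "f (\<lambda>_. 0) = (\<lambda>_. 0)" by (auto simp: f_def)
  have bU: "b x i = 0" if "\<not> U" "i \<in> {1..l1}" for x i using that by (simp add: b_def m_def)
  have dV: "d x j = 0" if "\<not> V" "j \<in> {1..l2}" for x j using that by (simp add: d_def n_def)
  have g0: "g (\<lambda>_. 0) = (\<lambda>_. 0)"
  proof -
    have "b (\<lambda>_. 0) = (\<lambda>_. 0)" "d (\<lambda>_. 0) = (\<lambda>_. 0)" by (auto simp: b_def d_def)
    moreover have "(\<lambda>_. 0 :: real) ` {1..l1} = {0}" "(\<lambda>_. 0 :: real) ` {1..l2} = {0}" using l by auto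
    ultimately show ?thesis by (auto simp: g_def fun_eq_iff split: ray.split)
  qed
  have f_in: "f w \<in> punctured (m + n)" if w: "w \<in> normal_forms l1 l2 R" for w
  proof -
    have "w \<noteq> (\<lambda>_. 0)" using w by (simp add: normal_forms_def)
    then have "f w \<noteq> (\<lambda>_. 0)" using gf[OF w] g0 by metis
    then show ?thesis by (simp add: punctured_def f_def)
  qed
  have g_in: "g x \<in> normal_forms l1 l2 R" if x: "x \<in> punctured (m + n)" for x
  proof -
    have "x \<noteq> (\<lambda>_. 0)" using x by (simp add: punctured_def)
    then have "g x \<noteq> (\<lambda>_. 0)" using fg[OF x] f0 by metis
    moreover have "0 \<le> g x r" for r
      by (auto simp: g_def split: ray.split intro!: Min_le)
    moreover have "g x r = 0" if "r \<notin> R" for r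
    proof (cases r)
      case (URay i)
      show ?thesis
      proof (cases "i \<in> {1..l1}")
        case True
        then have "\<not> U" using that by (auto simp: R URay)
        then have "b x ` {1..l1} = {0}" using bU l by auto
        then show ?thesis using bU[OF \<open>\<not> U\<close> True] by (simp add: g_def URay)
      next
        case False
        then show ?thesis by (auto simp: g_def URay)
      qed
    next
      case (VRay j)
      show ?thesis
      proof (cases "j \<in> {1..l2}")
        case True
        then have "\<not> V" using that by (auto simp: R VRay)
        then have "d x ` {1..l2} = {0}" using dV l by auto
        then show ?thesis using dV[OF \<open>\<not> V\<close> True] by (simp add: g_def VRay)
      next
        case False
        then show ?thesis by (auto simp: g_def VRay)
      qed
    qed
    moreover have "\<exists>i\<in>{1..l1}. g x (URay i) = 0"
    proof -
      have "Min (b x ` {1..l1}) \<in> b x ` {1..l1}" using l by (intro Min_in) auto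
      then show ?thesis by (auto simp: g_def)
    qed
    moreover have "\<exists>j\<in>{1..l2}. g x (VRay j) = 0"
    proof -
      have "Min (d x ` {1..l2}) \<in> d x ` {1..l2}" using l by (intro Min_in) auto
      then show ?thesis by (auto simp: g_def)
    qed
    ultimately show ?thesis unfolding normal_forms_def by blast
  qed
  have "continuous_on UNIV (\<lambda>w. f w k)" for k
    unfolding f_def
    by (cases "k < m"; cases "k < m + n") (auto intro!: continuous_intros continuous_on_product_coordinates)
  then have "continuous_on UNIV f" by (rule continuous_on_coordinatewise_then_product)
  then have f_cont: "continuous_map (powertop_real UNIV) (powertop_real UNIV) f"
    by (simp add: euclidean_product_topology)
  have "continuous_on UNIV (\<lambda>x. g x r)" for r
  proof -
    have b: "continuous_on UNIV (\<lambda>x. b x i)" for i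
      unfolding b_def by (cases "i \<le> m") (auto intro!: continuous_on_product_coordinates)
    have d: "continuous_on UNIV (\<lambda>x. d x j)" for j
      unfolding d_def by (cases "j \<le> n") (auto intro!: continuous_on_product_coordinates)
    have bm: "continuous_on UNIV (\<lambda>x. Min ((\<lambda>i. b x i) ` {1..l1}))"
      using l b by (intro continuous_on_Min) auto
    have dm: "continuous_on UNIV (\<lambda>x. Min ((\<lambda>i. d x i) ` {1..l2}))"
      using l d by (intro continuous_on_Min) auto
    show ?thesis
    proof (cases r)
      case (URay i)
      show ?thesis unfolding g_def URay ray.case
        by (cases "i \<in> {1..l1}")
          (simp_all only: if_True if_False continuous_on_diff[OF b bm] continuous_on_const)
    next
      case (VRay j)
      show ?thesis unfolding g_def VRay ray.case
        by (cases "j \<in> {1..l2}")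
          (simp_all only: if_True if_False continuous_on_diff[OF d dm] continuous_on_const)
    qed
  qed
  then have "continuous_on UNIV g" by (rule continuous_on_coordinatewise_then_product)
  then have g_cont: "continuous_map (powertop_real UNIV) (powertop_real UNIV) g"
    by (simp add: euclidean_product_topology)
  have "homeomorphic_maps (subtopology (powertop_real UNIV) (normal_forms l1 l2 R))
      (subtopology (powertop_real UNIV) (punctured (m + n))) f g"
    unfolding homeomorphic_maps_def continuous_map_in_subtopology
    using continuous_map_from_subtopology[OF f_cont] continuous_map_from_subtopology[OF g_cont]
      f_in g_in fg gf by auto
  then show ?thesis unfolding homeomorphic_space_def m_def n_def by blast
qed

lemma tempting_iff_whole_family:
  assumes "l1 \<ge> 2" and "l2 \<ge> 2"
  shows "tempting TYPE('k::field) l1 l2 c R \<longleftrightarrow> R \<in> whole_families l1 l2"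
proof (cases "R \<subseteq> rays l1 l2")
  case False
  then show ?thesis by (auto simp: tempting_def whole_families_def rays_def)
next
  case sub: True
  have l: "l1 \<ge> 1" "l2 \<ge> 1" using assms by auto
  let ?V = "subtopology (N_space l1 l2 c) (V_gt l1 l2 c R)"
  let ?K = "subtopology (powertop_real UNIV) (normal_forms l1 l2 R)"
  have homeo: "?V homeomorphic_space ?K" by (rule V_gt_homeomorphic_normal_forms[OF l sub])
  have acyclic: "acyclic_space TYPE('k) ?V \<longleftrightarrow> acyclic_space TYPE('k) ?K"
    using acyclic_space_homeomorphic[OF homeo] acyclic_space_homeomorphic[OF homeo[THEN homeomorphic_space_sym[THEN iffD1]]]
    by blast
  show ?thesis
  proof (cases "R \<in> whole_families l1 l2")
    case False
    then have "acyclic_space TYPE('k) ?K" using acyclic_normal_forms sub l by blast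
    then show ?thesis using False acyclic by (simp add: tempting_def)
  next
    case True
    have "\<not> acyclic_space TYPE('k) ?K"
    proof (cases "R = {}")
      case True
      then have "normal_forms l1 l2 R = {}" by (auto simp: normal_forms_def)
      then show ?thesis by (simp add: acyclic_space_def)
    next
      case False
      obtain U V where R: "R = (if U then URay ` {1..l1} else {}) \<union> (if V then VRay ` {1..l2} else {})"
        and "U \<or> V"
      proof -
        have "R = URay ` {1..l1} \<or> R = VRay ` {1..l2} \<or> R = URay ` {1..l1} \<union> VRay ` {1..l2}"
          using True False by (auto simp: whole_families_def rays_def)
        then show thesis using that[of True False] that[of False True] that[of True True] by auto
      qed
      then have "(if U then l1 - 1 else 0) + (if V then l2 - 1 else 0) \<ge> 1" using assms by auto
      then show ?thesis
        using not_acyclic_punctured acyclic_space_homeomorphic[OF normal_forms_homeomorphic_punctured[OF l R]]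
        by blast
    qed
    then show ?thesis using True sub acyclic by (simp add: tempting_def)
  qed
qed

section \<open>The immaculate line bundles\<close>

theorem theorem6p2:
  fixes l1 l2 :: nat and c :: "nat \<Rightarrow> int"
  assumes "l1 \<ge> 2" and "l2 \<ge> 2"
    and "c 1 = 0"
    and "\<And>i j. 1 \<le> i \<Longrightarrow> i \<le> j \<Longrightarrow> j \<le> l2 \<Longrightarrow> c j \<le> c i"
  shows "Imm_int TYPE('k::alg_closed_field) l1 l2 c = Imm_real TYPE('k) l1 l2 c \<and>
    (\<forall>x y :: int. immaculate TYPE('k) l1 l2 c (x, y) \<longleftrightarrow>
        (- int l2 < y \<and> y < 0) \<or>
        (y \<ge> 0 \<and> - int l1 < x \<and> x < c l2 * y) \<or>
        (y \<le> - int l2 \<and> 0 > x + (\<Sum>\<nu>=1..l2. c \<nu>) \<and>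
          x + (\<Sum>\<nu>=1..l2. c \<nu>) > c l2 * (y + int l2) - int l1))"
proof -
  have l: "l1 \<ge> 1" "l2 \<ge> 1" using assms(1,2) by auto
  have anti: "monotone_on {1..l2} (\<le>) (\<ge>) c"
    using assms(4) by (auto simp: monotone_on_def)
  note regions = mem_maculate_none[of l1 l2 c, OF l assms(3) anti] mem_maculate_U[of l1 l2 c, OF l assms(3) anti]
    mem_maculate_V[of l1 l2 c, OF l assms(3) anti] mem_maculate_rays[of l1 l2 c, OF l assms(3) anti]
  have Union: "(\<Union>R\<in>whole_families l1 l2. maculate l1 l2 c R) =
      maculate l1 l2 c {} \<union> maculate l1 l2 c (URay ` {1..l1}) \<union>
      maculate l1 l2 c (VRay ` {1..l2}) \<union> (maculate l1 l2 c (rays l1 l2) :: ('a::linordered_idom \<times> 'a) set)"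
    by (auto simp: whole_families_def)
  \<comment> \<open>All inequalities that describe the regions are inequalities between integers.\<close>
  have of_int: "(of_int x, of_int y) \<in> (\<Union>R\<in>whole_families l1 l2. maculate l1 l2 c R :: (real \<times> real) set)
      \<longleftrightarrow> (x, y) \<in> (\<Union>R\<in>whole_families l1 l2. maculate l1 l2 c R)" for x y :: int
  proof -
    have "real_of_int (c l2) * real_of_int y \<le> real_of_int x \<longleftrightarrow> c l2 * y \<le> x"
      "real_of_int x \<le> - real l1 \<longleftrightarrow> x \<le> - int l1"
      "real_of_int y \<le> - real l2 \<longleftrightarrow> y \<le> - int l2"
      "0 \<le> real_of_int x + real_of_int (\<Sum>j=1..l2. c j) \<longleftrightarrow> 0 \<le> x + (\<Sum>j=1..l2. c j)"
      "real_of_int x + real_of_int (\<Sum>j=1..l2. c j) \<le> real_of_int (c l2) * (real_of_int y + real l2) - real l1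
        \<longleftrightarrow> x + (\<Sum>j=1..l2. c j) \<le> c l2 * (y + int l2) - int l1"
      unfolding of_int_of_nat_eq[symmetric, where 'a = real] of_int_mult[symmetric] of_int_add[symmetric]
        of_int_minus[symmetric] of_int_diff[symmetric] of_int_le_iff of_int_0_le_iff by (rule refl)+
    then show ?thesis unfolding Union Un_iff regions by simp
  qed
  have "immaculate TYPE('k) l1 l2 c (x, y) \<longleftrightarrow>
        (- int l2 < y \<and> y < 0) \<or>
        (y \<ge> 0 \<and> - int l1 < x \<and> x < c l2 * y) \<or>
        (y \<le> - int l2 \<and> 0 > x + (\<Sum>\<nu>=1..l2. c \<nu>) \<and>
          x + (\<Sum>\<nu>=1..l2. c \<nu>) > c l2 * (y + int l2) - int l1)" for x y
    unfolding immaculate_iff_not_maculate[OF l] Union Un_iff regions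
    using assms(2) by auto
  moreover have "Imm_int TYPE('k) l1 l2 c = Imm_real TYPE('k) l1 l2 c"
    unfolding Imm_int_def Imm_real_def tempting_iff_whole_family[OF assms(1,2)] Collect_mem_eq
    using of_int by auto
  ultimately show ?thesis by blast
qed

end
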